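(* Let $\Phi : M_2(\mathbb{C})\to M_2(\mathbb{C})$ be a completely positive and trace-preserving linear map such that for every state the sequence of its iterates under $\Phi$ converges to a stationary state. Let $\rho$ be a state on $M_2(\mathbb{C})$, and let $\rho_\infty=\begin{pmatrix}\alpha_\infty & \beta_\infty\\ \overline{\beta}_\infty & 1-\alpha_\infty\end{pmatrix}$ denote the stationary state which is the limit of $\Phi^n(\rho)$. Put $v_1=2\,\mathrm{Re}(\beta_\infty)$, $v_2=-2\,\mathrm{Im}(\beta_\infty)$, $v_3=2\alpha_\infty-1$, and let $\omega=\rho\otimes\Phi(\rho)\otimes\Phi^2(\rho)\otimes\cdots$ and the processes $X^{(n)}_t,Y^{(n)}_t,Z^{(n)}_t$ be as defined in the context. Assume that $$\Phi^n(\rho)=\rho_\infty+o\!\left(\tfrac{1}{\sqrt n}\right)\quad (n\to\infty).$$ Then for every $m\ge 1$, every polynomial $P$ in $3m$ variables and all $0\le t_1<t_2<\dots<t_m$, $$\lim_{n\to+\infty}\omega\left[\widehat{P}\big(X^{(n)}_{t_1},Y^{(n)}_{t_1},Z^{(n)}_{t_1},\dots,X^{(n)}_{t_m},Y^{(n)}_{t_m},Z^{(n)}_{t_m}\big)\right]=\mathbb{E}\left[P\big(B^{(1)}_{t_1},B^{(2)}_{t_1},B^{(3)}_{t_1},\dots,B^{(1)}_{t_m},B^{(2)}_{t_m},B^{(3)}_{t_m}\big)\right],$$ where $\widehat P$ is the totally symmetrized polynomial of $P$ and $(B^{(1)}_t,B^{(2)}_t,B^{(3)}_t)_{t\ge 0}$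 is a three-dimensional centered Brownian motion with covariance matrix $Ct$, where $$C=\begin{pmatrix}1-v_1^2 & -v_1v_2 & -v_1v_3\\ -v_1v_2 & 1-v_2^2 & -v_2v_3\\ -v_1v_3 & -v_2v_3 & 1-v_3^2\end{pmatrix}.$$
   Context: A state on $M_2(\mathbb{C})$ is identified with a density matrix $\rho$ (positive semi-definite, trace one), acting by $A\mapsto \mathrm{Trace}(A\rho)$. A stationary state is a state $\rho_\infty$ with $\Phi(\rho_\infty)=\rho_\infty$. The Pauli matrices are $$\sigma_x=\begin{pmatrix}0&1\\1&0\end{pmatrix},\quad \sigma_y=\begin{pmatrix}0&-i\\ i&0\end{pmatrix},\quad \sigma_z=\begin{pmatrix}1&0\\0&-1\end{pmatrix}.$$ Let $M_1,M_2,\dots$ be copies of $M_2(\mathbb{C})$ and consider the infinite tensor product algebra $M_1\otimes M_2\otimes\cdots$ (in the sense of $W^*$-algebras) with respect to the product state $\omega=\rho\otimes\Phi(\rho)\otimes\Phi^2(\rho)\otimes\cdots$, so the $k$-th factor ($k\ge1$) carries the state $\Phi^{k-1}(\rho)$. Thus $\omega[A_1\otimes\cdots\otimes A_N\otimes I\otimes I\otimes\cdots]=\prod_{k=1}^N\mathrm{Trace}(A_k\Phi^{k-1}(\rho))$. For $k\ge 1$ let $$x_k=I\otimes\cdots\otimes I\otimes(\sigma_x-v_1I)\otimes I\otimes\cdots,\quad y_k=I\otimes\cdots\otimes I\otimes(\sigma_y-v_2I)\otimes I\otimes\cdots,\quad z_k=I\otimes\cdots\otimes I\otimes(\sigma_z-v_3I)\otimes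 I\otimes\cdots,$$ where the non-identity factor is in the $k$-th place. Set $X_n=\sum_{k=1}^n x_k$, $Y_n=\sum_{k=1}^n y_k$, $Z_n=\sum_{k=1}^n z_k$, $X_0=Y_0=Z_0=0$, and, for real $t\ge0$, with $[\cdot]$ the integer part, $$X^{(n)}_t=n^{-1/2}X_{[nt]},\quad Y^{(n)}_t=n^{-1/2}Y_{[nt]},\quad Z^{(n)}_t=n^{-1/2}Z_{[nt]}.$$ For a polynomial $P$, its totally symmetrized polynomial $\widehat P$ (a polynomial in non-commuting variables) is obtained by replacing, linearly, each monomial by its symmetrization: $$X_{i_1}X_{i_2}\cdots X_{i_k}\longmapsto\frac{1}{k!}\sum_{\sigma\in S_k}X_{i_{\sigma(1)}}\cdots X_{i_{\sigma(k)}},$$ where $S_k$ is the group of permutations of $\{1,\dots,k\}$. A three-dimensional centered Brownian motion with covariance matrix $Ct$ is a continuous centered Gaussian process starting at $0$ with independent stationary increments and $\mathbb{E}[B^{(i)}_tB^{(j)}_t]=C_{ij}t$ ($C$ may be degenerate). *)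

theory Defs
  imports
    "HOL-Probability.Probability"
    "HOL-Combinatorics.Permutations"
    "HOL-Library.Poly_Mapping"
    "HOL-Library.Landau_Symbols"
begin

section \<open>States and channels on \<open>M\<^sub>2(\<complex>)\<close>\<close>

type_synonym cmat2 = "complex^2^2"

definition dagger :: "cmat2 \<Rightarrow> cmat2" where
  "dagger A = (\<chi> i j. cnj (A $ j $ i))"

text \<open>Positive semi-definiteness of the \<open>n \<times> n\<close> block matrix \<open>[A i j]\<close> with entries in
  \<open>M\<^sub>2(\<complex>)\<close>; being a nonnegative real for all \<open>v\<close> includes that the form is Hermitian.\<close>

definition block_psd :: "nat \<Rightarrow> (nat \<Rightarrow> nat \<Rightarrow> cmat2) \<Rightarrow> bool" where
  "block_psd n A \<longleftrightarrow>
     (\<forall>v :: nat \<Rightarrow> complex^2.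
        (\<Sum>i<n. \<Sum>j<n. \<Sum>r\<in>UNIV. cnj (v i $ r) * (A i j *v v j) $ r) \<in> \<real>\<^sub>\<ge>\<^sub>0)"

definition psd :: "cmat2 \<Rightarrow> bool" where
  "psd A \<longleftrightarrow> (\<forall>v :: complex^2. (\<Sum>r\<in>UNIV. cnj (v $ r) * (A *v v) $ r) \<in> \<real>\<^sub>\<ge>\<^sub>0)"

definition density_matrix :: "cmat2 \<Rightarrow> bool" where
  "density_matrix D \<longleftrightarrow> psd D \<and> trace D = 1"

definition complex_linear_map :: "(cmat2 \<Rightarrow> cmat2) \<Rightarrow> bool" where
  "complex_linear_map F \<longleftrightarrow>
     (\<forall>A B. F (A + B) = F A + F B) \<and> (\<forall>c A. F (mat c ** A) = mat c ** F A)"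

definition completely_positive :: "(cmat2 \<Rightarrow> cmat2) \<Rightarrow> bool" where
  "completely_positive F \<longleftrightarrow>
     (\<forall>n A. block_psd n A \<longrightarrow> block_psd n (\<lambda>i j. F (A i j)))"

definition trace_preserving :: "(cmat2 \<Rightarrow> cmat2) \<Rightarrow> bool" where
  "trace_preserving F \<longleftrightarrow> (\<forall>A. trace (F A) = trace A)"

definition stationary :: "(cmat2 \<Rightarrow> cmat2) \<Rightarrow> cmat2 \<Rightarrow> bool" where
  "stationary F D \<longleftrightarrow> density_matrix D \<and> F D = D"

definition sigma_x :: cmat2 where
  "sigma_x = vector [vector [0, 1], vector [1, 0]]"

definition sigma_y :: cmat2 where
  "sigma_y = vector [vector [0, - \<i>], vector [\<i>, 0]]"

definition sigma_z :: cmat2 where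
  "sigma_z = vector [vector [1, 0], vector [0, - 1]]"


section \<open>The infinite tensor product of copies of \<open>M\<^sub>2(\<complex>)\<close> with respect to a product state\<close>

text \<open>
  Given density matrices \<open>D\<^sub>0, D\<^sub>1, \<dots>\<close>, the \<open>k\<close>-th copy of \<open>M\<^sub>2(\<complex>)\<close> acts by left
  multiplication on the Hilbert space \<open>M\<^sub>2(\<complex>)\<close> with the inner product
  \<open>\<langle>U, V\<rangle> = Trace(U\<^sup>* V)\<close>, where the state \<open>A \<mapsto> Trace(A D\<^sub>k)\<close> is the vector state of a
  unit vector \<open>\<xi>\<^sub>k\<close> with \<open>\<xi>\<^sub>k \<xi>\<^sub>k\<^sup>* = D\<^sub>k\<close>. The infinite tensor product is the von Neumann
  algebra generated by the copies of \<open>M\<^sub>2(\<complex>)\<close> on von Neumann's incomplete tensor product of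
  these Hilbert spaces along \<open>\<xi>\<^sub>0 \<otimes> \<xi>\<^sub>1 \<otimes> \<dots>\<close>, and the product state is the vector state of
  \<open>\<xi>\<^sub>0 \<otimes> \<xi>\<^sub>1 \<otimes> \<dots>\<close>.

  Completing every \<open>\<xi>\<^sub>k\<close> to an orthonormal basis \<open>e\<^sub>k\<close> with \<open>e\<^sub>k 0 = \<xi>\<^sub>k\<close>, the vectors
  \<open>e\<^sub>0 (c 0) \<otimes> e\<^sub>1 (c 1) \<otimes> \<dots>\<close>, for the finitely supported \<open>c\<close>, form an orthonormal basis of
  the incomplete tensor product. Bounded operators are given by their matrices in that basis.
\<close>

definition hs_inner :: "cmat2 \<Rightarrow> cmat2 \<Rightarrow> complex" where
  "hs_inner U V = trace (dagger U ** V)"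

definition is_purification_basis :: "cmat2 \<Rightarrow> (4 \<Rightarrow> cmat2) \<Rightarrow> bool" where
  "is_purification_basis D e \<longleftrightarrow>
     (\<forall>a b. hs_inner (e a) (e b) = (if a = b then 1 else 0)) \<and> e 0 ** dagger (e 0) = D"

definition purification_basis :: "cmat2 \<Rightarrow> 4 \<Rightarrow> cmat2" where
  "purification_basis D = (SOME e. is_purification_basis D e)"

type_synonym conf = "nat \<Rightarrow>\<^sub>0 4"

type_synonym op_matrix = "conf \<Rightarrow> conf \<Rightarrow> complex"

text \<open>A matrix is that of a bounded operator iff its sesquilinear form is bounded on
  finitely supported vectors. The series in the product of two such matrices converge absolutely.\<close>

definition bounded_op :: "op_matrix \<Rightarrow> bool" where
  "bounded_op a \<longleftrightarrow>
     (\<exists>K. \<forall>F (u :: conf \<Rightarrow> complex) v.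
        finite F \<and> (\<Sum>i\<in>F. (cmod (u i))\<^sup>2) \<le> 1 \<and> (\<Sum>i\<in>F. (cmod (v i))\<^sup>2) \<le> 1 \<longrightarrow>
        cmod (\<Sum>i\<in>F. \<Sum>j\<in>F. cnj (u i) * a i j * v j) \<le> K)"

definition op_id :: op_matrix where
  "op_id = (\<lambda>i j. if i = j then 1 else 0)"

definition op_mult :: "op_matrix \<Rightarrow> op_matrix \<Rightarrow> op_matrix" where
  "op_mult a b = (\<lambda>i j. \<Sum>\<^sub>\<infinity>l. a i l * b l j)"

definition commutant :: "op_matrix set \<Rightarrow> op_matrix set" where
  "commutant S = {b. bounded_op b \<and> (\<forall>a\<in>S. op_mult a b = op_mult b a)}"

text \<open>\<open>I \<otimes> \<dots> \<otimes> I \<otimes> A \<otimes> I \<otimes> \<dots>\<close> with \<open>A\<close> in the factor number \<open>k\<close> (counted from \<open>0\<close>)\<close>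

definition at_site :: "(nat \<Rightarrow> cmat2) \<Rightarrow> nat \<Rightarrow> cmat2 \<Rightarrow> op_matrix" where
  "at_site D k A = (\<lambda>i j.
     if \<forall>l. l \<noteq> k \<longrightarrow> Poly_Mapping.lookup i l = Poly_Mapping.lookup j l
     then hs_inner (purification_basis (D k) (Poly_Mapping.lookup i k)) (A ** purification_basis (D k) (Poly_Mapping.lookup j k))
     else 0)"

text \<open>The generating set is closed under adjoints, so by the bicommutant theorem this is the
  von Neumann algebra it generates.\<close>

definition tensor_algebra :: "(nat \<Rightarrow> cmat2) \<Rightarrow> op_matrix set" where
  "tensor_algebra D = commutant (commutant (\<Union>k. range (at_site D k)))"

definition product_state :: "(nat \<Rightarrow> cmat2) \<Rightarrow> op_matrix \<Rightarrow> complex" where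
  "product_state D = (\<lambda>a\<in>tensor_algebra D. a 0 0)"

definition scaled_sum :: "(nat \<Rightarrow> cmat2) \<Rightarrow> cmat2 \<Rightarrow> nat \<Rightarrow> real \<Rightarrow> op_matrix" where
  "scaled_sum D A n t = (\<lambda>i j.
     complex_of_real (1 / sqrt (real n)) * (\<Sum>k<nat \<lfloor>real n * t\<rfloor>. at_site D k A i j))"


section \<open>Polynomials and total symmetrization\<close>

text \<open>Polynomials in the variables \<open>0, 1, 2, \<dots>\<close>: a monomial is its finitely supported exponent
  function. A polynomial in non-commuting variables is a linear combination of words.\<close>

type_synonym monomial = "nat \<Rightarrow>\<^sub>0 nat"
type_synonym cpoly = "monomial \<Rightarrow>\<^sub>0 complex"
type_synonym nc_poly = "nat list \<Rightarrow>\<^sub>0 complex"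

definition poly_in_vars :: "nat \<Rightarrow> cpoly \<Rightarrow> bool" where
  "poly_in_vars r P \<longleftrightarrow> (\<forall>\<mu>\<in>Poly_Mapping.keys P. Poly_Mapping.keys \<mu> \<subseteq> {..<r})"

definition poly_eval :: "complex list \<Rightarrow> cpoly \<Rightarrow> complex" where
  "poly_eval xs P = (\<Sum>\<mu>\<in>Poly_Mapping.keys P. Poly_Mapping.lookup P \<mu> * (\<Prod>x\<in>Poly_Mapping.keys \<mu>. (xs ! x) ^ Poly_Mapping.lookup \<mu> x))"

definition monomial_word :: "monomial \<Rightarrow> nat list" where
  "monomial_word \<mu> = concat (map (\<lambda>x. replicate (Poly_Mapping.lookup \<mu> x) x) (sorted_list_of_set (Poly_Mapping.keys \<mu>)))"

definition symmetrized_monomial :: "monomial \<Rightarrow> complex \<Rightarrow> nc_poly" where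
  "symmetrized_monomial \<mu> c =
     (let w = monomial_word \<mu>; k = length w
      in \<Sum>\<pi> | \<pi> permutes {..<k}. Poly_Mapping.single (permute_list \<pi> w) (c / fact k))"

definition symmetrized :: "cpoly \<Rightarrow> nc_poly" where
  "symmetrized P = (\<Sum>\<mu>\<in>Poly_Mapping.keys P. symmetrized_monomial \<mu> (Poly_Mapping.lookup P \<mu>))"

definition nc_eval :: "op_matrix list \<Rightarrow> nc_poly \<Rightarrow> op_matrix" where
  "nc_eval as Q = (\<lambda>i j.
     \<Sum>w\<in>Poly_Mapping.keys Q. Poly_Mapping.lookup Q w * foldr op_mult (map (\<lambda>x. as ! x) w) op_id i j)"


section \<open>Brownian motion with a possibly degenerate covariance matrix\<close>

definition (in prob_space) centered_gaussian :: "('a \<Rightarrow> real) \<Rightarrow> bool" where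
  "centered_gaussian X \<longleftrightarrow>
     random_variable borel X \<and>
     ((AE w in M. X w = 0) \<or> (\<exists>s>0. distributed M lborel X (normal_density 0 s)))"

locale centered_brownian_motion_3d = prob_space M for M :: "'w measure" +
  fixes C :: "real^3^3" and B :: "real \<Rightarrow> 'w \<Rightarrow> real^3"
  assumes random_vector: "\<And>t. 0 \<le> t \<Longrightarrow> random_variable borel (B t)"
    and start: "AE w in M. B 0 w = 0"
    and continuous_paths: "AE w in M. continuous_on {0..} (\<lambda>t. B t w)"
    and gaussian: "\<And>T (c :: real \<Rightarrow> real^3). finite T \<Longrightarrow> T \<subseteq> {0..} \<Longrightarrow>
          centered_gaussian (\<lambda>w. \<Sum>t\<in>T. c t \<bullet> B t w)"
    and independent_increments: "\<And>n (s :: nat \<Rightarrow> real).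
          0 \<le> s 0 \<Longrightarrow> (\<And>i. i < n \<Longrightarrow> s i \<le> s (Suc i)) \<Longrightarrow>
          indep_vars (\<lambda>_. borel) (\<lambda>i w. B (s (Suc i)) w - B (s i) w) {..<n}"
    and stationary_increments: "\<And>s h. 0 \<le> s \<Longrightarrow> 0 \<le> h \<Longrightarrow>
          distr M borel (\<lambda>w. B (s + h) w - B s w) = distr M borel (\<lambda>w. B h w - B 0 w)"
    and covariance: "\<And>t i j. 0 \<le> t \<Longrightarrow>
          expectation (\<lambda>w. B t w $ i * B t w $ j) = C $ i $ j * t"


section \<open>Consistency: the product state on elementary tensors\<close>

text \<open>The choice in \<^const>\<open>purification_basis\<close> exists for every density matrix
  (lemma \<open>purification_basis\<close>), all products of one-site operators lie in the von Neumann algebra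
  (lemma \<open>word_in_algebra\<close>), and the product state of \<open>A\<^sub>0 \<otimes> \<dots> \<otimes> A\<^sub>N\<^sub>-\<^sub>1 \<otimes> I \<otimes> \<dots>\<close> is the product of the
  \<open>Trace(A\<^sub>k D\<^sub>k)\<close> (lemma \<open>product_state_formula\<close>).\<close>

lemma psd_entries:
  assumes "psd A"
  obtains a d where "A$1$1 = complex_of_real a" "A$2$2 = complex_of_real d" "0 \<le> a" "0 \<le> d"
    "A$2$1 = cnj (A$1$2)" "(cmod (A$1$2))\<^sup>2 \<le> a * d"
proof -
  define q where "q x y = cnj x * (A$1$1 * x + A$1$2 * y) + cnj y * (A$2$1 * x + A$2$2 * y)" for x y
  have q: "q x y \<in> \<real>\<^sub>\<ge>\<^sub>0" for x y
  proof -
    have "(\<Sum>r\<in>UNIV. cnj ((vector [x,y] :: complex^2) $ r) * (A *v vector [x,y]) $ r) \<in> \<real>\<^sub>\<ge>\<^sub>0"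
      using assms unfolding psd_def by blast
    thus ?thesis by (simp add: q_def sum_2 matrix_vector_mult_def)
  qed
  have q1: "A$1$1 \<in> \<real>\<^sub>\<ge>\<^sub>0" using q[of 1 0] by (simp add: q_def)
  have q2: "A$2$2 \<in> \<real>\<^sub>\<ge>\<^sub>0" using q[of 0 1] by (simp add: q_def)
  define a where "a = Re (A$1$1)"
  define d where "d = Re (A$2$2)"
  have a: "A$1$1 = complex_of_real a" "0 \<le> a" using q1 by (auto simp: a_def complex_nonneg_Reals_iff complex_eq_iff)
  have d: "A$2$2 = complex_of_real d" "0 \<le> d" using q2 by (auto simp: d_def complex_nonneg_Reals_iff complex_eq_iff)
  have 1: "A$2$1 = cnj (A$1$2)"
    using q[of 1 1] q[of 1 \<i>] by (auto simp: q_def a d complex_nonneg_Reals_iff complex_eq_iff)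
  let ?b = "A$1$2"
  have main: "0 \<le> a * s\<^sup>2 * (cmod ?b)\<^sup>2 + 2 * s * t * (cmod ?b)\<^sup>2 + d * t\<^sup>2" for s t :: real
    using q[of "of_real s * ?b" "of_real t"]
    unfolding cmod_power2
    by (auto simp: q_def a d 1 complex_nonneg_Reals_iff power2_eq_square algebra_simps)
  have "(cmod ?b)\<^sup>2 \<le> a * d"
  proof (cases "a = 0")
    case True
    have "0 \<le> a * (d+1)\<^sup>2 * (cmod ?b)\<^sup>2 + 2 * (d+1) * (-(cmod ?b)\<^sup>2) * (cmod ?b)\<^sup>2 + d * (-(cmod ?b)\<^sup>2)\<^sup>2"
      by (rule main)
    hence "0 \<le> - (d + 2) * ((cmod ?b)\<^sup>2)\<^sup>2" using True by (simp add: algebra_simps power2_eq_square)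
    moreover have "(d + 2) * Y > 0" if "Y > 0" for Y :: real using that d(2) by simp
    ultimately have "((cmod ?b)\<^sup>2)\<^sup>2 \<le> 0" by (smt (verit) minus_mult_left)
    thus ?thesis by (simp add: True)
  next
    case False
    hence a0: "a > 0" using a by simp
    have "0 \<le> a * (-1)\<^sup>2 * (cmod ?b)\<^sup>2 + 2 * (-1) * a * (cmod ?b)\<^sup>2 + d * a\<^sup>2" by (rule main)
    hence "a * (cmod ?b)\<^sup>2 \<le> a * (a * d)" by (simp add: algebra_simps power2_eq_square)
    thus ?thesis using a0 by simp
  qed
  thus ?thesis using that a d 1 by blast
qed

lemma hs_inner_entries:
  "hs_inner U V = cnj (U$1$1) * V$1$1 + cnj (U$1$2) * V$1$2 + cnj (U$2$1) * V$2$1 + cnj (U$2$2) * V$2$2"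
  by (simp add: hs_inner_def dagger_def trace_def matrix_matrix_mult_def sum_2)

lemma sqrt_exists:
  assumes "psd A"
  obtains p r s where "(vector [vector [complex_of_real p, 0], vector [r, s]] :: cmat2) **
     dagger (vector [vector [complex_of_real p, 0], vector [r, s]]) = A"
proof -
  from psd_entries[OF assms] obtain a d where
   e: "A$1$1 = complex_of_real a" "A$2$2 = complex_of_real d" "0 \<le> a" "0 \<le> d"
    "A$2$1 = cnj (A$1$2)" and le: "(cmod (A$1$2))\<^sup>2 \<le> a * d" by blast
  show thesis
  proof (cases "a = 0")
    case True
    with le have "A$1$2 = 0" by simp
    thus thesis using e True
      by (intro that[of 0 0 "complex_of_real (sqrt d)"])
        (simp add: vec_eq_iff forall_2 matrix_matrix_mult_def dagger_def sum_2 flip: of_real_mult)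
  next
    case False
    hence a0: "a > 0" using e by simp
    let ?c = "d - (cmod (A$1$2))\<^sup>2 / a"
    have c: "?c \<ge> 0" using le a0 by (simp add: field_simps)
    have 1: "cnj (A$1$2) * A$1$2 = of_real ((cmod (A$1$2))\<^sup>2)"
      by (metis complex_norm_square mult.commute)
    have 2: "complex_of_real (sqrt a) * complex_of_real (sqrt a) = of_real a"
      using a0 by (simp flip: of_real_mult)
    have 3: "complex_of_real (sqrt ?c) * complex_of_real (sqrt ?c) = of_real ?c"
      using c by (simp flip: of_real_mult)
    have ne: "complex_of_real (sqrt a) \<noteq> 0" using a0 by simp
    have 4: "cnj (A$1$2) / complex_of_real (sqrt a) * cnj (cnj (A$1$2) / complex_of_real (sqrt a))
        + complex_of_real (sqrt ?c) * cnj (complex_of_real (sqrt ?c)) = of_real d"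
    proof -
      have "cnj (A$1$2) / complex_of_real (sqrt a) * cnj (cnj (A$1$2) / complex_of_real (sqrt a))
        = of_real ((cmod (A$1$2))\<^sup>2) / of_real a"
        by (simp only: complex_cnj_divide complex_cnj_cnj complex_cnj_complex_of_real times_divide_times_eq 1 2)
      thus ?thesis by (simp add: 3) 
    qed
    show thesis
      using 2 4 ne e
      by (intro that[of "sqrt a" "cnj (A$1$2) / of_real (sqrt a)" "of_real (sqrt ?c)"])
        (simp add: vec_eq_iff forall_2 matrix_matrix_mult_def dagger_def sum_2)
  qed
qed

lemma purification_basis:
  assumes "density_matrix D"
  shows "is_purification_basis D (purification_basis D)"
proof -
  from assms obtain p r s where
    E: "(vector [vector [complex_of_real p, 0], vector [r, s]] :: cmat2) **
     dagger (vector [vector [complex_of_real p, 0], vector [r, s]]) = D" (is "?E ** _ = _")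
    using sqrt_exists unfolding density_matrix_def by blast
  have "trace (?E ** dagger ?E) = 1" using assms E unfolding density_matrix_def by simp
  hence n: "complex_of_real p * of_real p + r * cnj r + s * cnj s = 1"
    by (simp add: trace_def matrix_matrix_mult_def sum_2 dagger_def add.assoc)
  define e :: "4 \<Rightarrow> cmat2" where "e k =
     (if k = 0 then ?E else if k = 1 then
       (if p = 1 then vector [vector [0,0], vector[1,0]] else
       vector [vector [cnj r, 0], vector [1 - r * cnj r / (1 - p), - s * cnj r / (1 - p)]])
      else if k = 2 then
       (if p = 1 then vector [vector [0,0], vector[0,1]] else
       vector [vector [cnj s, 0], vector [- r * cnj s / (1 - p), 1 - s * cnj s / (1 - p)]])
      else vector [vector [0, 1], vector [0, 0]])" for k
  have [simp]: "(4::4) = 0" "(1::4) \<noteq> 0" "(2::4) \<noteq> 0" "(3::4) \<noteq> 0" "(0::4) \<noteq> 1" "(0::4) \<noteq> 2" "(0::4) \<noteq> 3"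
   "(1::4) \<noteq> 2" "(2::4) \<noteq> 1" "(1::4) \<noteq> 3" "(3::4) \<noteq> 1" "(3::4) \<noteq> 2" "(2::4) \<noteq> 3" by simp_all
  have rs: "p = 1 \<Longrightarrow> r = 0 \<and> s = 0"
  proof -
    assume "p = 1"
    hence "r * cnj r + s * cnj s = 0" using n by simp
    hence "complex_of_real ((cmod r)\<^sup>2 + (cmod s)\<^sup>2) = 0" by (simp only: of_real_add complex_norm_square)
    hence "(cmod r)\<^sup>2 + (cmod s)\<^sup>2 = 0" using of_real_eq_0_iff by blast
    thus ?thesis by (simp add: sum_power2_eq_zero_iff)
  qed
  have "hs_inner (e a) (e b) = (if a = b then 1 else 0)" for a b
  proof (cases "p = 1")
    case True
    thus ?thesis using rs exhaust_4[of a] exhaust_4[of b] 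
      by (auto simp: hs_inner_entries e_def)
  next
    case False
    have ne: "1 - complex_of_real p \<noteq> 0" using False by (metis eq_iff_diff_eq_0 of_real_eq_1_iff)
    define q where "q = 1 / (1 - complex_of_real p)"
    have q: "q * (1 - complex_of_real p) = 1" "cnj q = q" using ne by (auto simp: q_def)
    have dq: "x / (1 - complex_of_real p) = x * q" for x by (simp add: q_def)
    have qp: "q * of_real p = q - 1" using q(1) by (simp add: algebra_simps)
    have K2: "q * (r * cnj r + s * cnj s) = 1 + of_real p"
    proof -
      have "r * cnj r + s * cnj s = (1 - of_real p) * (1 + of_real p)"
        using n by (simp add: algebra_simps)
      thus ?thesis using q(1) by (simp add: mult.assoc[symmetric])
    qed
    have K: "q * (q * (r * cnj r + s * cnj s)) = 2 * q - 1"
      unfolding K2 using qp by (simp add: algebra_simps)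
    have e0: "e 0 = vector [vector [of_real p, 0], vector [r, s]]"
      and e1: "e 1 = vector [vector [cnj r, 0], vector [1 - q * r * cnj r, - q * s * cnj r]]"
      and e2: "e 2 = vector [vector [cnj s, 0], vector [- q * r * cnj s, 1 - q * s * cnj s]]"
      and e3: "e 3 = vector [vector [0, 1], vector [0, 0]]"
      using False by (simp_all add: e_def dq mult_ac)
    have h: "hs_inner (vector [vector [w, x], vector [y, z]]) (vector [vector [w', x'], vector [y', z']])
       = cnj w * w' + cnj x * x' + cnj y * y' + cnj z * z'" for w x y z w' x' y' z'
      by (simp add: hs_inner_entries)
    note c = complex_cnj_diff complex_cnj_mult complex_cnj_minus complex_cnj_cnj complex_cnj_one complex_cnj_zero q(2) complex_cnj_complex_of_real
    have 01: "hs_inner (e 0) (e 1) = 0"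
    proof -
      have "hs_inner (e 0) (e 1) = cnj r * (1 + of_real p - q * (r * cnj r + s * cnj s))"
        unfolding e0 e1 h c by (simp add: algebra_simps)
      thus ?thesis by (simp add: K2)
    qed
    have 02: "hs_inner (e 0) (e 2) = 0"
    proof -
      have "hs_inner (e 0) (e 2) = cnj s * (1 + of_real p - q * (r * cnj r + s * cnj s))"
        unfolding e0 e2 h c by (simp add: algebra_simps)
      thus ?thesis by (simp add: K2)
    qed
    have 12: "hs_inner (e 1) (e 2) = 0"
    proof -
      have "hs_inner (e 1) (e 2) = r * cnj s * (1 - 2 * q + q * (q * (r * cnj r + s * cnj s)))"
        unfolding e1 e2 h c by (simp add: algebra_simps)
      thus ?thesis by (simp add: K)
    qed
    have 11: "hs_inner (e 1) (e 1) = 1"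
    proof -
      have "hs_inner (e 1) (e 1) = 1 + r * cnj r * (1 - 2 * q + q * (q * (r * cnj r + s * cnj s)))"
        unfolding e1 h c by (simp add: algebra_simps)
      thus ?thesis by (simp add: K)
    qed
    have 22: "hs_inner (e 2) (e 2) = 1"
    proof -
      have "hs_inner (e 2) (e 2) = 1 + s * cnj s * (1 - 2 * q + q * (q * (r * cnj r + s * cnj s)))"
        unfolding e2 h c by (simp add: algebra_simps)
      thus ?thesis by (simp add: K)
    qed
    have 00: "hs_inner (e 0) (e 0) = 1"
      unfolding e0 h c using n by (simp add: algebra_simps)
    have 3: "hs_inner (e 3) (e 3) = 1" "hs_inner (e 0) (e 3) = 0" "hs_inner (e 1) (e 3) = 0" "hs_inner (e 2) (e 3) = 0"
      unfolding e0 e1 e2 e3 h by simp_all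
    have sym: "hs_inner U V = cnj (hs_inner V U)" for U V by (simp add: hs_inner_entries mult_ac)
    have "a = 0 \<or> a = 1 \<or> a = 2 \<or> a = 3" "b = 0 \<or> b = 1 \<or> b = 2 \<or> b = 3"
      using exhaust_4[of a] exhaust_4[of b] by auto
    thus ?thesis
      using 00 01 02 11 12 22 3 sym[of "e 1" "e 0"] sym[of "e 2" "e 0"] sym[of "e 2" "e 1"]
        sym[of "e 3" "e 0"] sym[of "e 3" "e 1"] sym[of "e 3" "e 2"]
      by (elim disjE) simp_all
  qed
  moreover have "e 0 ** dagger (e 0) = D" using E by (simp add: e_def)
  ultimately have "is_purification_basis D e" by (auto simp: is_purification_basis_def)
  thus ?thesis unfolding purification_basis_def by (metis someI)
qed

text \<open>Matrices with uniformly few nonzero entries per row and column and bounded entries; for these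
  the series in the products are finite sums.\<close>

definition "rows_ok (K::nat) (a :: op_matrix) \<longleftrightarrow> (\<forall>i. finite {j. a i j \<noteq> 0} \<and> card {j. a i j \<noteq> 0} \<le> K)"
definition "local_op a \<longleftrightarrow> (\<exists>K c. rows_ok K a \<and> rows_ok K (\<lambda>i j. a j i) \<and> (\<forall>i j. cmod (a i j) \<le> c))"

lemma op_mult_finite_row:
  assumes "finite {l. a i l \<noteq> 0}"
  shows "op_mult a b i j = (\<Sum>l | a i l \<noteq> 0. a i l * b l j)"
proof -
  have "op_mult a b i j = infsum (\<lambda>l. a i l * b l j) {l. a i l \<noteq> 0}"
    unfolding op_mult_def by (rule infsum_cong_neutral) auto
  thus ?thesis using assms by simp
qed

lemma op_mult_finite_col:
  assumes "finite {l. b l j \<noteq> 0}"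
  shows "op_mult a b i j = (\<Sum>l | b l j \<noteq> 0. a i l * b l j)"
proof -
  have "op_mult a b i j = infsum (\<lambda>l. a i l * b l j) {l. b l j \<noteq> 0}"
    unfolding op_mult_def by (rule infsum_cong_neutral) auto
  thus ?thesis using assms by simp
qed

lemma rows_ok_mult:
  assumes "rows_ok K a" "rows_ok L b"
  shows "rows_ok (K * L) (op_mult a b)"
  unfolding rows_ok_def
proof
  fix i
  let ?U = "\<Union>l\<in>{l. a i l \<noteq> 0}. {j. b l j \<noteq> 0}"
  have sub: "{j. op_mult a b i j \<noteq> 0} \<subseteq> ?U"
  proof
    fix j assume "j \<in> {j. op_mult a b i j \<noteq> 0}"
    hence "(\<Sum>l | a i l \<noteq> 0. a i l * b l j) \<noteq> 0"
      using assms op_mult_finite_row[of a i b j] by (simp add: rows_ok_def)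
    then obtain l where "a i l \<noteq> 0" "a i l * b l j \<noteq> 0" by (metis (mono_tags, lifting) mem_Collect_eq sum.not_neutral_contains_not_neutral)
    thus "j \<in> ?U" by auto
  qed
  have fin: "finite ?U" using assms by (auto simp: rows_ok_def)
  have "card ?U \<le> (\<Sum>l | a i l \<noteq> 0. card {j. b l j \<noteq> 0})"
    using assms by (intro card_UN_le) (auto simp: rows_ok_def)
  also have "\<dots> \<le> (\<Sum>l | a i l \<noteq> 0. L)" using assms by (intro sum_mono) (auto simp: rows_ok_def)
  also have "\<dots> \<le> K * L" using assms by (simp add: rows_ok_def)
  finally show "finite {j. op_mult a b i j \<noteq> 0} \<and> card {j. op_mult a b i j \<noteq> 0} \<le> K * L"
    using sub fin by (meson card_mono finite_subset le_trans)
qed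

lemma op_mult_transpose: "(\<lambda>i j. op_mult a b j i) = op_mult (\<lambda>i j. b j i) (\<lambda>i j. a j i)"
  by (simp add: op_mult_def mult.commute)

lemma local_mult:
  assumes "local_op a" "local_op b" shows "local_op (op_mult a b)"
proof -
  obtain K c L d where a: "rows_ok K a" "rows_ok K (\<lambda>i j. a j i)" "\<And>i j. cmod (a i j) \<le> c"
    and b: "rows_ok L b" "rows_ok L (\<lambda>i j. b j i)" "\<And>i j. cmod (b i j) \<le> d"
    using assms unfolding local_op_def by metis
  have cd: "0 \<le> c" "0 \<le> d" using a(3) b(3) by (meson norm_ge_zero order_trans)+
  have "cmod (op_mult a b i j) \<le> K * (c * d)" for i j
  proof -
    have "cmod (op_mult a b i j) \<le> (\<Sum>l | a i l \<noteq> 0. cmod (a i l * b l j))"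
      using op_mult_finite_row[of a i b j] a(1) by (simp add: rows_ok_def norm_sum)
    also have "\<dots> \<le> (\<Sum>l | a i l \<noteq> 0. c * d)"
      using a b cd by (intro sum_mono) (auto simp: norm_mult intro!: mult_mono)
    also have "\<dots> \<le> K * (c * d)" using a(1) cd by (auto simp: rows_ok_def intro!: mult_right_mono)
    finally show ?thesis .
  qed
  moreover have "rows_ok (K * L) (\<lambda>i j. op_mult a b j i)"
    unfolding op_mult_transpose using rows_ok_mult[OF b(2) a(2)] by (simp add: mult.commute)
  ultimately show ?thesis unfolding local_op_def using rows_ok_mult[OF a(1) b(1)] by blast
qed

lemma local_bounded:
  assumes "local_op a" shows "bounded_op a"
proof -
  obtain K c where a: "rows_ok K a" "rows_ok K (\<lambda>i j. a j i)" "\<And>i j. cmod (a i j) \<le> c"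
    using assms unfolding local_op_def by metis
  have c: "0 \<le> c" using a(3) by (meson norm_ge_zero order_trans)
  have *: "(\<Sum>i\<in>F. \<Sum>j\<in>F. (if b i j \<noteq> 0 then f i else 0)) \<le> K * (\<Sum>i\<in>F. f i)"
    if "rows_ok K b" "finite F" "\<And>i. f i \<ge> 0" for b and f :: "conf \<Rightarrow> real" and F
  proof -
    have "(\<Sum>j\<in>F. (if b i j \<noteq> 0 then f i else 0)) \<le> K * f i" for i
    proof -
      have "(\<Sum>j\<in>F. (if b i j \<noteq> 0 then f i else 0)) = card {j\<in>F. b i j \<noteq> 0} * f i"
        using that by (simp add: sum.If_cases Int_def)
      also have "card {j\<in>F. b i j \<noteq> 0} \<le> card {j. b i j \<noteq> 0}"
        using that by (intro card_mono) (auto simp: rows_ok_def)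
      hence "card {j\<in>F. b i j \<noteq> 0} * f i \<le> K * f i"
        using that by (intro mult_right_mono) (auto simp: rows_ok_def intro: order_trans)
      finally show ?thesis .
    qed
    thus ?thesis by (simp add: sum_distrib_left sum_mono)
  qed
  show ?thesis unfolding bounded_op_def
  proof (intro exI[of _ "c * K"] allI impI; elim conjE)
    fix F :: "conf set" and u v :: "conf \<Rightarrow> complex"
    assume F: "finite F" "(\<Sum>i\<in>F. (cmod (u i))\<^sup>2) \<le> 1" "(\<Sum>i\<in>F. (cmod (v i))\<^sup>2) \<le> 1"
    have "cmod (\<Sum>i\<in>F. \<Sum>j\<in>F. cnj (u i) * a i j * v j)
        \<le> (\<Sum>i\<in>F. \<Sum>j\<in>F. cmod (cnj (u i) * a i j * v j))"
      by (intro order_trans[OF norm_sum] sum_mono norm_sum)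
    also have "\<dots> \<le> (\<Sum>i\<in>F. \<Sum>j\<in>F. c / 2 * ((if a i j \<noteq> 0 then (cmod (u i))\<^sup>2 else 0)
         + (if a i j \<noteq> 0 then (cmod (v j))\<^sup>2 else 0)))"
    proof (intro sum_mono)
      fix i j
      have "2 * cmod (u i) * cmod (v j) \<le> (cmod (u i))\<^sup>2 + (cmod (v j))\<^sup>2"
        by (rule sum_squares_bound)
      hence "cmod (a i j) * (cmod (u i) * cmod (v j)) \<le> c * (((cmod (u i))\<^sup>2 + (cmod (v j))\<^sup>2) / 2)"
        using a(3) c by (intro mult_mono) auto
      thus "cmod (cnj (u i) * a i j * v j) \<le> c / 2 * ((if a i j \<noteq> 0 then (cmod (u i))\<^sup>2 else 0)
         + (if a i j \<noteq> 0 then (cmod (v j))\<^sup>2 else 0))"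
        by (simp add: norm_mult algebra_simps)
    qed
    also have "\<dots> = c / 2 * ((\<Sum>i\<in>F. \<Sum>j\<in>F. if a i j \<noteq> 0 then (cmod (u i))\<^sup>2 else 0)
         + (\<Sum>j\<in>F. \<Sum>i\<in>F. if a i j \<noteq> 0 then (cmod (v j))\<^sup>2 else 0))"
      unfolding sum_distrib_left[symmetric] sum.distrib
      by (subst (2) sum.swap) (rule refl)
    also have "\<dots> \<le> c / 2 * (real K * 1 + real K * 1)"
    proof (intro mult_left_mono add_mono)
      have "real K * (\<Sum>i\<in>F. (cmod (u i))\<^sup>2) \<le> real K * 1" using F by (intro mult_left_mono) auto
      thus "(\<Sum>i\<in>F. \<Sum>j\<in>F. if a i j \<noteq> 0 then (cmod (u i))\<^sup>2 else 0) \<le> real K * 1"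
        using *[OF a(1) F(1), of "\<lambda>i. (cmod (u i))\<^sup>2"] by simp
      have "real K * (\<Sum>i\<in>F. (cmod (v i))\<^sup>2) \<le> real K * 1" using F by (intro mult_left_mono) auto
      thus "(\<Sum>j\<in>F. \<Sum>i\<in>F. if a i j \<noteq> 0 then (cmod (v j))\<^sup>2 else 0) \<le> real K * 1"
        using *[OF a(2) F(1), of "\<lambda>i. (cmod (v i))\<^sup>2"] by simp
    qed (use c in auto)
    finally show "cmod (\<Sum>i\<in>F. \<Sum>j\<in>F. cnj (u i) * a i j * v j) \<le> c * K" by simp
  qed
qed

lemma finite_rows: "local_op a \<Longrightarrow> finite {l. a i l \<noteq> 0}" "local_op a \<Longrightarrow> finite {l. a l i \<noteq> 0}"
  by (auto simp: local_op_def rows_ok_def)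

lemma assoc1:
  assumes "local_op a" "local_op b" shows "op_mult (op_mult a b) c = op_mult a (op_mult b c)"
proof (intro ext)
  fix i j
  let ?R = "{l. a i l \<noteq> 0}"
  let ?U = "\<Union>l\<in>?R. {k. b l k \<noteq> 0}"
  have fin: "finite ?R" "finite ?U" using assms by (auto intro: finite_rows)
  have m: "op_mult a b i k = (\<Sum>l\<in>?R. a i l * b l k)" for k by (rule op_mult_finite_row[of a i, OF fin(1)])
  have "op_mult (op_mult a b) c i j = (\<Sum>k | op_mult a b i k \<noteq> 0. op_mult a b i k * c k j)"
    by (rule op_mult_finite_row) (rule finite_rows[OF local_mult[OF assms]])
  also have "\<dots> = (\<Sum>k\<in>?U. op_mult a b i k * c k j)"
  proof (rule sum.mono_neutral_left[OF fin(2)])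
    show "{k. op_mult a b i k \<noteq> 0} \<subseteq> ?U"
    proof
      fix k assume "k \<in> {k. op_mult a b i k \<noteq> 0}"
      hence "(\<Sum>l\<in>?R. a i l * b l k) \<noteq> 0" by (simp add: m)
      then obtain l where "l \<in> ?R" "a i l * b l k \<noteq> 0"
        by (rule sum.not_neutral_contains_not_neutral)
      thus "k \<in> ?U" by auto
    qed
  qed auto
  also have "\<dots> = (\<Sum>l\<in>?R. \<Sum>k\<in>?U. a i l * (b l k * c k j))"
    unfolding m sum_distrib_right by (subst sum.swap) (simp add: mult.assoc)
  also have "\<dots> = (\<Sum>l\<in>?R. a i l * op_mult b c l j)"
  proof (rule sum.cong[OF refl])
    fix l assume l: "l \<in> ?R"
    have "op_mult b c l j = (\<Sum>k | b l k \<noteq> 0. b l k * c k j)"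
      by (rule op_mult_finite_row) (rule finite_rows[OF assms(2)])
    also have "\<dots> = (\<Sum>k\<in>?U. b l k * c k j)"
      using fin l by (intro sum.mono_neutral_left) auto
    finally show "(\<Sum>k\<in>?U. a i l * (b l k * c k j)) = a i l * op_mult b c l j"
      by (simp add: sum_distrib_left)
  qed
  also have "\<dots> = op_mult a (op_mult b c) i j" by (rule op_mult_finite_row[of a i, OF fin(1), symmetric])
  finally show "op_mult (op_mult a b) c i j = op_mult a (op_mult b c) i j" .
qed

lemma local_transpose: "local_op (\<lambda>i j. a j i) = local_op a"
  unfolding local_op_def by (intro ex_cong1) auto

lemma assoc2:
  assumes "local_op b" "local_op c" shows "op_mult (op_mult a b) c = op_mult a (op_mult b c)"
proof -
  have "op_mult (op_mult (\<lambda>i j. c j i) (\<lambda>i j. b j i)) (\<lambda>i j. a j i) = op_mult (\<lambda>i j. c j i) (op_mult (\<lambda>i j. b j i) (\<lambda>i j. a j i))"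
    using assms by (intro assoc1) (simp_all only: local_transpose[of b] local_transpose[of c])
  hence "(\<lambda>i j. op_mult a (op_mult b c) j i) = (\<lambda>i j. op_mult (op_mult a b) c j i)"
    by (simp only: op_mult_transpose[of b c, symmetric] op_mult_transpose[of a b, symmetric]
      op_mult_transpose[of a "op_mult b c", symmetric] op_mult_transpose[of "op_mult a b" c, symmetric])
  thus ?thesis by (simp add: fun_eq_iff)
qed

lemma assoc3:
  assumes "local_op a" "local_op c" shows "op_mult (op_mult a b) c = op_mult a (op_mult b c)"
proof (intro ext)
  fix i j
  have fin: "finite {l. a i l \<noteq> 0}" "finite {k. c k j \<noteq> 0}" using assms by (auto intro: finite_rows)
  show "op_mult (op_mult a b) c i j = op_mult a (op_mult b c) i j"
    unfolding op_mult_finite_row[of a i, OF fin(1)] op_mult_finite_col[of c j, OF fin(2)] sum_distrib_left sum_distrib_right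
    by (subst sum.swap) (simp add: mult.assoc)
qed

lemma local_id: "local_op op_id" "op_mult op_id a = a" "op_mult a op_id = a"
proof -
  have 1: "{j. op_id i j \<noteq> 0} = {i}" "{j. op_id j i \<noteq> 0} = {i}" for i by (auto simp: op_id_def)
  show "local_op op_id" unfolding local_op_def rows_ok_def
    by (intro exI[of _ 1]) (auto simp: 1, auto simp: op_id_def)
  show "op_mult op_id a = a" 
    by (intro ext, subst op_mult_finite_row) (simp_all add: 1, simp add: op_id_def)
  show "op_mult a op_id = a" 
    by (intro ext, subst op_mult_finite_col) (simp_all add: 1, simp add: op_id_def)
qed

lemma local_site: "local_op (at_site D k A)"
proof -
  have agree: "{j. \<forall>l. l \<noteq> k \<longrightarrow> Poly_Mapping.lookup i l = Poly_Mapping.lookup j l} \<subseteq> (\<lambda>x. Poly_Mapping.update k x i) ` UNIV" for i :: conf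
  proof
    fix j assume "j \<in> {j. \<forall>l. l \<noteq> k \<longrightarrow> Poly_Mapping.lookup i l = Poly_Mapping.lookup j l}"
    hence "j = Poly_Mapping.update k (Poly_Mapping.lookup j k) i"
      by (intro poly_mapping_eqI) (auto simp: lookup_update)
    thus "j \<in> (\<lambda>x. Poly_Mapping.update k x i) ` UNIV" by blast
  qed
  have c4: "finite S \<and> card S \<le> 4" if "S \<subseteq> (\<lambda>x :: 4. Poly_Mapping.update k x i) ` UNIV" for S and i :: conf
  proof -
    have "card S \<le> card ((\<lambda>x :: 4. Poly_Mapping.update k x i) ` UNIV)" using that by (intro card_mono) auto
    also have "\<dots> \<le> card (UNIV :: 4 set)" by (rule card_image_le) simp
    finally show ?thesis using that by (auto intro: finite_subset)
  qed
  let ?f = "\<lambda>(x,y). hs_inner (purification_basis (D k) x) (A ** purification_basis (D k) y)"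
  have "finite (range ?f)" by (rule finite_imageI) simp
  then obtain c where c: "\<And>x y. cmod (?f (x,y)) \<le> c"
    by (meson bounded_iff finite_imp_bounded rangeI)
  have "0 \<le> c" using c by (meson norm_ge_zero order_trans)
  hence "cmod (at_site D k A i j) \<le> c" for i j using c by (simp add: at_site_def)
  moreover have "rows_ok 4 (at_site D k A)"
    unfolding rows_ok_def by (intro allI c4) (rule order_trans[OF _ agree], auto simp: at_site_def)
  moreover have "rows_ok 4 (\<lambda>i j. at_site D k A j i)"
    unfolding rows_ok_def by (intro allI c4) (rule order_trans[OF _ agree], auto simp: at_site_def split: if_splits)
  ultimately show ?thesis unfolding local_op_def by blast
qed

lemma word_in_algebra:
  "local_op (foldr op_mult (map (\<lambda>(k,A). at_site D k A) ws) op_id) \<and>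
   foldr op_mult (map (\<lambda>(k,A). at_site D k A) ws) op_id \<in> tensor_algebra D"
proof (induction ws)
  case Nil
  show ?case by (auto simp: local_id tensor_algebra_def commutant_def[of "commutant _"] intro: local_bounded)
next
  case (Cons w ws)
  obtain k A where w: "w = (k, A)" by fastforce
  let ?s = "at_site D k A" and ?W = "foldr op_mult (map (\<lambda>(k,A). at_site D k A) ws) op_id"
  have l: "local_op ?s" "local_op ?W" "local_op (op_mult ?s ?W)"
    using Cons by (auto simp: local_site intro: local_mult)
  have "op_mult b (op_mult ?s ?W) = op_mult (op_mult ?s ?W) b"
    if b: "b \<in> commutant (\<Union>k. range (at_site D k))" for b
  proof -
    have s: "op_mult ?s b = op_mult b ?s" using b by (auto simp: commutant_def)
    have W: "op_mult b ?W = op_mult ?W b" using Cons b by (auto simp: tensor_algebra_def commutant_def[of "commutant _"])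
    have "op_mult b (op_mult ?s ?W) = op_mult (op_mult b ?s) ?W" by (simp add: assoc2 l)
    also have "\<dots> = op_mult ?s (op_mult b ?W)" by (simp add: s[symmetric] assoc3 l)
    also have "\<dots> = op_mult (op_mult ?s ?W) b" by (simp add: W assoc1 l)
    finally show ?thesis .
  qed
  thus ?case using l by (auto simp: w tensor_algebra_def commutant_def[of "commutant _"] intro: local_bounded)
qed

lemma product_state_formula:
  assumes "\<And>k. density_matrix (D k)"
  shows "product_state D (foldr op_mult (map (\<lambda>k. at_site D k (A k)) [0..<N]) op_id)
       = (\<Prod>k<N. trace (A k ** D k))"
proof -
  let ?h = "\<lambda>k i j. hs_inner (purification_basis (D k) (Poly_Mapping.lookup i k)) (A k ** purification_basis (D k) (Poly_Mapping.lookup j k))"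
  have form: "foldr op_mult (map (\<lambda>k. at_site D k (A k)) [n..<N]) op_id
     = (\<lambda>i j. if \<forall>l. l \<notin> {n..<N} \<longrightarrow> Poly_Mapping.lookup i l = Poly_Mapping.lookup j l then \<Prod>k\<in>{n..<N}. ?h k i j else 0)"
    if "n \<le> N" for n
    using that
  proof (induction n rule: inc_induct)
    case base
    have "(\<forall>l. Poly_Mapping.lookup i l = Poly_Mapping.lookup j l) \<longleftrightarrow> i = j" for i j :: conf
      by (metis poly_mapping_eqI)
    thus ?case by (intro ext) (simp add: op_id_def)
  next
    case (step n)
    show ?case
    proof (intro ext)
      fix i j :: conf
      let ?R = "foldr op_mult (map (\<lambda>k. at_site D k (A k)) [Suc n..<N]) op_id"
      let ?l = "Poly_Mapping.update n (Poly_Mapping.lookup j n) i"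
      have "op_mult (at_site D n (A n)) ?R i j = infsum (\<lambda>l. at_site D n (A n) i l * ?R l j) {?l}"
        unfolding op_mult_def[of "at_site D n (A n)" ?R]
      proof (rule infsum_cong_neutral)
        fix l assume "l \<in> UNIV - {?l}"
        hence "l \<noteq> ?l" by simp
        then obtain x where x: "Poly_Mapping.lookup l x \<noteq> Poly_Mapping.lookup ?l x" by (meson poly_mapping_eqI)
        show "at_site D n (A n) i l * ?R l j = 0"
        proof (cases "x = n")
          case True
          hence "?R l j = 0" using x by (auto simp: step.IH lookup_update intro!: exI[of _ n])
          thus ?thesis by simp
        next
          case False
          hence "at_site D n (A n) i l = 0" using x by (auto simp: at_site_def lookup_update)
          thus ?thesis by simp
        qed
      qed auto
      also have "\<dots> = at_site D n (A n) i ?l * ?R ?l j" by simp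
      also have "at_site D n (A n) i ?l = ?h n i j" by (simp add: at_site_def lookup_update)
      also have "?R ?l j = (if \<forall>l. l \<notin> {n..<N} \<longrightarrow> Poly_Mapping.lookup i l = Poly_Mapping.lookup j l then \<Prod>k\<in>{Suc n..<N}. ?h k i j else 0)"
      proof -
        have c1: "(\<forall>l. l \<notin> {Suc n..<N} \<longrightarrow> Poly_Mapping.lookup ?l l = Poly_Mapping.lookup j l)
           = (\<forall>l. l \<notin> {n..<N} \<longrightarrow> Poly_Mapping.lookup i l = Poly_Mapping.lookup j l)"
        proof -
          have mem: "l \<notin> {Suc n..<N} \<longleftrightarrow> l = n \<or> l \<notin> {n..<N}" and n: "n \<in> {n..<N}" for l
            using step.hyps by auto
          have upd: "Poly_Mapping.lookup ?l l = (if l = n then Poly_Mapping.lookup j n else Poly_Mapping.lookup i l)" for l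
            by (simp add: lookup_update)
          show ?thesis unfolding upd mem using n by metis
        qed
        have c2: "(\<Prod>k\<in>{Suc n..<N}. ?h k ?l j) = (\<Prod>k\<in>{Suc n..<N}. ?h k i j)"
          by (intro prod.cong refl) (simp add: lookup_update)
        show ?thesis by (simp only: step.IH c1 c2)
      qed
      finally have *: "op_mult (at_site D n (A n)) ?R i j = ?h n i j * (if \<forall>l. l \<notin> {n..<N} \<longrightarrow> Poly_Mapping.lookup i l = Poly_Mapping.lookup j l then \<Prod>k\<in>{Suc n..<N}. ?h k i j else 0)" .
      have if_zero: "x * (if c then y else 0) = (if c then x * y else 0)" for x y :: complex and c
        by simp
      have upt: "[n..<N] = n # [Suc n..<N]" using step.hyps by (simp add: upt_conv_Cons)
      have pr: "(\<Prod>k\<in>{n..<N}. ?h k i j) = ?h n i j * (\<Prod>k\<in>{Suc n..<N}. ?h k i j)"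
        using step.hyps by (simp add: prod.atLeast_Suc_lessThan)
      show "foldr op_mult (map (\<lambda>k. at_site D k (A k)) [n..<N]) op_id i j
        = (if \<forall>l. l \<notin> {n..<N} \<longrightarrow> Poly_Mapping.lookup i l = Poly_Mapping.lookup j l then \<Prod>k\<in>{n..<N}. ?h k i j else 0)"
        unfolding upt list.map foldr.simps o_apply * pr by (rule if_zero)
    qed
  qed
  have mem: "foldr op_mult (map (\<lambda>k. at_site D k (A k)) [0..<N]) op_id \<in> tensor_algebra D"
    using word_in_algebra[of D "map (\<lambda>k. (k, A k)) [0..<N]"] by (simp add: o_def)
  have "hs_inner (purification_basis (D k) 0) (A k ** purification_basis (D k) 0) = trace (A k ** D k)" for k
  proof -
    have "purification_basis (D k) 0 ** dagger (purification_basis (D k) 0) = D k"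
      using purification_basis[OF assms[of k]] by (simp add: is_purification_basis_def)
    thus ?thesis by (metis hs_inner_def matrix_mul_assoc trace_mul_sym)
  qed
  thus ?thesis using mem form[of 0] by (simp add: product_state_def atLeast0LessThan)
qed

end

theory Submission
imports Defs "HOL-Real_Asymp.Real_Asymp"
begin

text \<open>By polarization, a totally symmetrized monomial is a linear combination of powers of sums of its
  letters, and the same holds for commuting variables. It therefore suffices to compute the limits
  of \<open>\<omega>[L\<^sup>p]\<close> for \<open>L = n\<^sup>-\<^sup>1\<^sup>/\<^sup>2 \<Sum>\<^sub>k A\<^sub>k\<close>, where \<open>A\<^sub>k\<close> acts on the \<open>k\<close>-th factor only. The \<open>A\<^sub>k\<close> commute and are
  independent under the product state, so the exponential generating function of the moments of
  \<open>\<Sum>\<^sub>k A\<^sub>k\<close> is the product of those of the single sites. The logarithmic derivative of this product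
  yields a recursion for its coefficients, which in the limit becomes the recursion of the
  moments of a centered Gaussian variable: the rate \<open>o(n\<^sup>-\<^sup>1\<^sup>/\<^sup>2)\<close> makes the first-order terms vanish,
  and the second-order terms converge as Cesaro means. The variance only sees the
  anticommutators of the centered Pauli matrices, whose expectations are \<open>2C\<close>.\<close>

section \<open>The algebra of local operators\<close>

text \<open>The commutator of the unscaled X and Y sums, divided by n, is 2i times an average of
  \<open>sigma_z\<close> and tends to a multiple of 2i v3. So the scaled sums need not commute in
  the limit, and moments in a fixed order would contain such terms; powers of a single linear form
  only see the symmetric part. Letters with different times fit into one linear form as well: site k
  carries the sum of those letters whose time has not yet elapsed. This operator depends on n and on
  k, so the limit theorem for coefficients concerns a doubly indexed family with uniform bounds. The
  bounds exist because only finitely many subsets of letters occur. A second obstacle is that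
  \<open>op_mult\<close> is an infinite series, so products of arbitrary matrices need not be
  associative or additive, and that \<open>product_state\<close> is specified on
  \<open>tensor_algebra\<close> only. All operators are therefore kept in a subset of the algebra
  whose rows and columns are finite.\<close>

lemma op_mult_scale_left: "op_mult (\<lambda>i j. c * a i j) b = (\<lambda>i j. c * op_mult a b i j)"
  by (simp add: op_mult_def infsum_cmult_right' mult.assoc)

lemma op_mult_scale_right: "op_mult a (\<lambda>i j. c * b i j) = (\<lambda>i j. c * op_mult a b i j)"
proof -
  have "a i l * (c * b l j) = c * (a i l * b l j)" for i j l by simp
  thus ?thesis by (simp only: op_mult_def infsum_cmult_right')
qed

text \<open>Finite rows of \<open>a\<close> or finite columns of \<open>b\<close> leave finitely
  many nonzero terms. \<open>infsum\<close> is additive only for summable families, so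
  distributivity rests on this.\<close>

lemma summable_op_mult:
  assumes "local_op a \<or> local_op b"
  shows "(\<lambda>l. a i l * b l j) summable_on UNIV"
proof -
  obtain S where S: "finite S" "\<And>l. l \<notin> S \<Longrightarrow> a i l * b l j = 0"
    using assms finite_rows(1)[of a i] finite_rows(2)[of b j] by fastforce
  have "(\<lambda>l. a i l * b l j) summable_on S" using S by simp
  thus ?thesis by (rule summable_on_cong_neutral[THEN iffD1, rotated -1]) (use S in auto)
qed

text \<open>Elements of a commutant are bounded but need not be local, so locality may be demanded
  on one side of the product only.\<close>

lemma op_mult_add_left:
  assumes "(local_op a \<and> local_op a') \<or> local_op b"
  shows "op_mult (\<lambda>i j. a i j + a' i j) b = (\<lambda>i j. op_mult a b i j + op_mult a' b i j)"
proof -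
  have "local_op a \<or> local_op b" "local_op a' \<or> local_op b" using assms by auto
  thus ?thesis
    by (simp add: op_mult_def algebra_simps infsum_add summable_op_mult)
qed

lemma op_mult_add_right:
  assumes "local_op a \<or> (local_op b \<and> local_op b')"
  shows "op_mult a (\<lambda>i j. b i j + b' i j) = (\<lambda>i j. op_mult a b i j + op_mult a b' i j)"
proof -
  have "local_op a \<or> local_op b" "local_op a \<or> local_op b'" using assms by auto
  thus ?thesis
    by (simp add: op_mult_def algebra_simps infsum_add summable_op_mult)
qed

lemma rows_ok_add:
  assumes "rows_ok K a" "rows_ok L b"
  shows "rows_ok (K + L) (\<lambda>i j. a i j + b i j)"
  unfolding rows_ok_def
proof
  fix i
  have sub: "{j. a i j + b i j \<noteq> 0} \<subseteq> {j. a i j \<noteq> 0} \<union> {j. b i j \<noteq> 0}" by auto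
  have fin: "finite ({j. a i j \<noteq> 0} \<union> {j. b i j \<noteq> 0})" using assms by (auto simp: rows_ok_def)
  have "card ({j. a i j \<noteq> 0} \<union> {j. b i j \<noteq> 0}) \<le> K + L"
    using assms by (intro order_trans[OF card_Un_le] add_mono) (auto simp: rows_ok_def)
  thus "finite {j. a i j + b i j \<noteq> 0} \<and> card {j. a i j + b i j \<noteq> 0} \<le> K + L"
    using sub fin by (meson card_mono finite_subset le_trans)
qed

lemma local_add:
  assumes "local_op a" "local_op b" shows "local_op (\<lambda>i j. a i j + b i j)"
proof -
  obtain K c L d where a: "rows_ok K a" "rows_ok K (\<lambda>i j. a j i)" "\<And>i j. cmod (a i j) \<le> c"
    and b: "rows_ok L b" "rows_ok L (\<lambda>i j. b j i)" "\<And>i j. cmod (b i j) \<le> d"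
    using assms unfolding local_op_def by metis
  have "cmod (a i j + b i j) \<le> c + d" for i j
    using a(3) b(3) by (meson add_mono norm_triangle_le)
  thus ?thesis unfolding local_op_def using rows_ok_add[OF a(1) b(1)] rows_ok_add[OF a(2) b(2)] by blast
qed

lemma local_scale:
  assumes "local_op a" shows "local_op (\<lambda>i j. c * a i j)"
proof -
  obtain K d where a: "rows_ok K a" "rows_ok K (\<lambda>i j. a j i)" "\<And>i j. cmod (a i j) \<le> d"
    using assms unfolding local_op_def by metis
  have "rows_ok K (\<lambda>i j. c * a' i j)" if "rows_ok K a'" for a'
    unfolding rows_ok_def
  proof
    fix i
    have "{j. c * a' i j \<noteq> 0} \<subseteq> {j. a' i j \<noteq> 0}" by auto
    thus "finite {j. c * a' i j \<noteq> 0} \<and> card {j. c * a' i j \<noteq> 0} \<le> K"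
      using that unfolding rows_ok_def by (meson card_mono finite_subset le_trans)
  qed
  moreover have "cmod (c * a i j) \<le> cmod c * d" for i j
    using a(3) by (simp add: norm_mult mult_left_mono)
  ultimately show ?thesis unfolding local_op_def using a by blast
qed

text \<open>Inside this set two questions are settled at once: products are finite sums, and
  \<open>product_state\<close>, which is \<open>undefined\<close> off \<open>tensor_algebra\<close>,
  is the vacuum entry.\<close>

definition local_algebra :: "(nat \<Rightarrow> cmat2) \<Rightarrow> op_matrix set" where
  "local_algebra D = {a \<in> tensor_algebra D. local_op a}"

lemma mem_tensor_algebra_iff:
  "local_op a \<Longrightarrow> a \<in> tensor_algebra D \<longleftrightarrow>
     (\<forall>b \<in> commutant (\<Union>k. range (at_site D k)). op_mult b a = op_mult a b)"
  by (auto simp: tensor_algebra_def commutant_def[of "commutant _"] local_bounded)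

lemma local_algebra_add:
  "a \<in> local_algebra D \<Longrightarrow> b \<in> local_algebra D \<Longrightarrow> (\<lambda>i j. a i j + b i j) \<in> local_algebra D"
  by (auto simp: local_algebra_def local_add mem_tensor_algebra_iff op_mult_add_left op_mult_add_right)

lemma local_algebra_scale:
  "a \<in> local_algebra D \<Longrightarrow> (\<lambda>i j. c * a i j) \<in> local_algebra D"
  by (auto simp: local_algebra_def local_scale mem_tensor_algebra_iff op_mult_scale_left op_mult_scale_right)

lemma local_algebra_id: "op_id \<in> local_algebra D"
  by (auto simp: local_algebra_def mem_tensor_algebra_iff local_id)

lemma local_algebra_at_site: "at_site D k A \<in> local_algebra D"
  by (auto simp: local_algebra_def mem_tensor_algebra_iff local_site) (auto simp: commutant_def)

lemma local_algebra_mult: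
  assumes "a \<in> local_algebra D" "b \<in> local_algebra D"
  shows "op_mult a b \<in> local_algebra D"
proof -
  have l: "local_op a" "local_op b" "local_op (op_mult a b)"
    using assms by (auto simp: local_algebra_def intro: local_mult)
  have "op_mult x (op_mult a b) = op_mult (op_mult a b) x"
    if x: "x \<in> commutant (\<Union>k. range (at_site D k))" for x
  proof -
    have a: "op_mult x a = op_mult a x" and b: "op_mult x b = op_mult b x"
      using assms l x by (auto simp: local_algebra_def mem_tensor_algebra_iff)
    \<comment> \<open>\<open>x\<close> is an arbitrary element of the commutant. Each regrouping
      uses the associativity law that asks for locality of exactly the other two factors.\<close>
    have "op_mult x (op_mult a b) = op_mult (op_mult x a) b" by (simp add: assoc2 l)
    also have "\<dots> = op_mult a (op_mult x b)" by (simp add: a assoc3 l)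
    also have "\<dots> = op_mult (op_mult a b) x" by (simp add: b assoc1 l)
    finally show ?thesis .
  qed
  thus ?thesis using l by (simp add: local_algebra_def mem_tensor_algebra_iff)
qed

lemma local_algebra_zero: "(\<lambda>i j. 0) \<in> local_algebra D"
  using local_algebra_scale[OF local_algebra_id, of 0] by simp

lemma local_algebra_sum:
  "(\<And>k. k \<in> J \<Longrightarrow> X k \<in> local_algebra D) \<Longrightarrow> (\<lambda>i j. \<Sum>k\<in>J. X k i j) \<in> local_algebra D"
  by (induction J rule: infinite_finite_induct) (auto simp: local_algebra_zero local_algebra_add)

lemma local_algebra_local: "a \<in> local_algebra D \<Longrightarrow> local_op a"
  by (simp add: local_algebra_def)

lemma local_algebra_foldr:
  "(\<And>a. a \<in> set as \<Longrightarrow> a \<in> local_algebra D) \<Longrightarrow> foldr op_mult as op_id \<in> local_algebra D"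
  by (induction as) (auto simp: local_algebra_id local_algebra_mult)

lemma local_algebra_scaled_sum: "scaled_sum D A n t \<in> local_algebra D"
  unfolding scaled_sum_def
  by (intro local_algebra_scale local_algebra_sum local_algebra_at_site)

lemma product_state_local: "a \<in> local_algebra D \<Longrightarrow> product_state D a = a 0 0"
  by (simp add: product_state_def local_algebra_def)

lemma op_mult_zero_left: "op_mult (\<lambda>i j. 0) b = (\<lambda>i j. 0)"
  by (simp add: op_mult_def)

lemma op_mult_zero_right: "op_mult b (\<lambda>i j. 0) = (\<lambda>i j. 0)"
  by (simp add: op_mult_def)

lemma op_mult_sum_left:
  assumes "\<And>k. k \<in> J \<Longrightarrow> X k \<in> local_algebra D"
  shows "op_mult (\<lambda>i j. \<Sum>k\<in>J. X k i j) b = (\<lambda>i j. \<Sum>k\<in>J. op_mult (X k) b i j)"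
  using assms
proof (induction J rule: infinite_finite_induct)
  case (insert x F)
  thus ?case 
    by (simp add: op_mult_add_left local_algebra_local[of _ D] local_algebra_sum)
qed (simp_all add: op_mult_zero_left)

lemma op_mult_sum_right:
  assumes "a \<in> local_algebra D"
  shows "op_mult a (\<lambda>i j. \<Sum>k\<in>J. X k i j) = (\<lambda>i j. \<Sum>k\<in>J. op_mult a (X k) i j)"
proof (induction J rule: infinite_finite_induct)
  case (insert x F)
  thus ?case using assms
    by (simp add: op_mult_add_right local_algebra_local[of _ D])
qed (simp_all add: op_mult_zero_right)

lemma foldr_op_mult_scale:
  "foldr op_mult (replicate p (\<lambda>i j. c * a i j)) op_id =
     (\<lambda>i j. c ^ p * foldr op_mult (replicate p a) op_id i j)"
  by (induction p) (simp_all add: op_mult_scale_left op_mult_scale_right mult.assoc)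

abbreviation words :: "'k set \<Rightarrow> nat \<Rightarrow> 'k list set" where
  "words J p \<equiv> {xs. set xs \<subseteq> J \<and> length xs = p}"

lemma sum_words_Suc:
  assumes "finite J"
  shows "(\<Sum>xs\<in>words J (Suc p). f xs) = (\<Sum>k\<in>J. \<Sum>xs\<in>words J p. f (k # xs))"
proof -
  have eq: "words J (Suc p) = (\<lambda>(k, xs). k # xs) ` (J \<times> words J p)"
    by (auto simp: length_Suc_conv image_iff)
  have "inj_on (\<lambda>(k, xs). k # xs) (J \<times> words J p)" by (auto simp: inj_on_def)
  thus ?thesis
    by (simp add: eq sum.reindex sum.cartesian_product case_prod_unfold)
qed

text \<open>The noncommutative multinomial expansion. It is used twice: over the positions in a
  monomial for polarization, and over the sites for the moments.\<close>

lemma foldr_op_mult_sum_power: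
  assumes "finite J" "\<And>k. k \<in> J \<Longrightarrow> X k \<in> local_algebra D"
  shows "foldr op_mult (replicate p (\<lambda>i j. \<Sum>k\<in>J. X k i j)) op_id =
     (\<lambda>i j. \<Sum>xs\<in>words J p. foldr op_mult (map X xs) op_id i j)"
proof (induction p)
  case 0
  have "words J 0 = {[]}" by auto
  thus ?case by simp
next
  case (Suc p)
  have "foldr op_mult (replicate (Suc p) (\<lambda>i j. \<Sum>k\<in>J. X k i j)) op_id =
     op_mult (\<lambda>i j. \<Sum>k\<in>J. X k i j) (\<lambda>i j. \<Sum>xs\<in>words J p. foldr op_mult (map X xs) op_id i j)"
    by (simp only: replicate_Suc foldr_Cons o_apply Suc)
  also have "\<dots> = (\<lambda>i j. \<Sum>k\<in>J. \<Sum>xs\<in>words J p. op_mult (X k) (foldr op_mult (map X xs) op_id) i j)"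
    using assms by (simp add: op_mult_sum_left[of _ _ D] op_mult_sum_right[of _ D])
  finally show ?case using assms by (simp add: sum_words_Suc)
qed

section \<open>Expectations of words of one-site operators\<close>

text \<open>Parseval's identity. Four orthonormal vectors in a space of dimension four are complete:
  orthonormality says \<open>F ** G = mat 1\<close>, and for square matrices this gives
  \<open>G ** F = mat 1\<close>.\<close>

lemma purification_basis_complete:
  assumes "density_matrix D"
  shows "(\<Sum>b\<in>UNIV. hs_inner U (purification_basis D b) * hs_inner (purification_basis D b) V) = hs_inner U V"
proof -
  define e where "e = purification_basis D"
  define vc :: "cmat2 \<Rightarrow> complex^4" where "vc W = vector [W$1$1, W$1$2, W$2$1, W$2$2]" for W
  have vc: "vc W $ 1 = W$1$1" "vc W $ 2 = W$1$2" "vc W $ 3 = W$2$1" "vc W $ 4 = W$2$2" for W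
    by (simp_all add: vc_def vector_def)
  have inner: "hs_inner V W = (\<Sum>k\<in>UNIV. cnj (vc V $ k) * vc W $ k)" for V W
    by (simp add: hs_inner_entries sum_4 vc[unfolded numeral_eq_Suc] vc del: One_nat_def)
  define F G :: "complex^4^4" where "F = (\<chi> a k. cnj (vc (e a) $ k))" and "G = (\<chi> k b. vc (e b) $ k)"
  have "is_purification_basis D e" unfolding e_def by (rule purification_basis[OF assms])
  hence "F ** G = mat 1"
    by (simp add: F_def G_def matrix_matrix_mult_def mat_def vec_eq_iff is_purification_basis_def inner)
  hence "G ** F = mat 1" by (simp add: matrix_left_right_inverse)
  hence GF: "(\<Sum>b\<in>UNIV. vc (e b) $ k * cnj (vc (e b) $ l)) = (if k = l then 1 else 0)" for k l
    by (simp add: F_def G_def matrix_matrix_mult_def mat_def vec_eq_iff)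
  have "(\<Sum>b\<in>UNIV. hs_inner U (e b) * hs_inner (e b) V)
    = (\<Sum>b\<in>UNIV. \<Sum>k\<in>UNIV. \<Sum>l\<in>UNIV. cnj (vc U $ k) * vc V $ l * (vc (e b) $ k * cnj (vc (e b) $ l)))"
    unfolding inner sum_product by (intro sum.cong refl) (simp only: mult_ac)
  also have "\<dots> = (\<Sum>k\<in>UNIV. \<Sum>l\<in>UNIV. \<Sum>b\<in>UNIV. cnj (vc U $ k) * vc V $ l * (vc (e b) $ k * cnj (vc (e b) $ l)))"
    by (subst sum.swap, rule sum.cong[OF refl], rule sum.swap)
  also have "\<dots> = (\<Sum>k\<in>UNIV. \<Sum>l\<in>UNIV. cnj (vc U $ k) * vc V $ l * (if k = l then 1 else 0))"
    by (simp only: sum_distrib_left[symmetric] GF)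
  also have "\<dots> = (\<Sum>k\<in>UNIV. cnj (vc U $ k) * vc V $ k)"
    by (simp add: if_distrib cong: if_cong)
  finally show ?thesis by (simp add: e_def inner)
qed

lemma hs_inner_mult_left: "hs_inner U (A ** V) = hs_inner (dagger A ** U) V"
proof -
  have "dagger (X ** Y) = dagger Y ** dagger X" for X Y
    by (simp add: dagger_def matrix_matrix_mult_def vec_eq_iff mult.commute)
  moreover have "dagger (dagger A) = A" by (simp add: dagger_def vec_eq_iff)
  ultimately show ?thesis by (simp add: hs_inner_def matrix_mul_assoc)
qed

text \<open>Letters at different sites commute, so all that matters of a word is the order of its
  letters within each site.\<close>

definition site_product :: "(nat \<times> cmat2) list \<Rightarrow> nat \<Rightarrow> cmat2" where
  "site_product ws l = foldr (**) (map snd (filter (\<lambda>w. fst w = l) ws)) (mat 1)"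

text \<open>A word sends the vacuum to a product vector whose component at site l is the operator
  \<open>site_product ws l\<close> applied to the vacuum component there; the right-hand side is its
  expansion in the product basis. The row stays arbitrary because peeling off the leftmost letter
  changes it at one site.\<close>

lemma word_column_zero:
  assumes dens: "\<And>k. density_matrix (D k)"
  assumes "fst ` set ws \<subseteq> {..<N}"
  shows "foldr op_mult (map (\<lambda>(k,A). at_site D k A) ws) op_id i 0 =
    (if \<forall>l\<ge>N. Poly_Mapping.lookup i l = 0
     then \<Prod>l<N. hs_inner (purification_basis (D l) (Poly_Mapping.lookup i l))
            (site_product ws l ** purification_basis (D l) 0) else 0)"
  using assms(2)
proof (induction ws arbitrary: i)
  case Nil
  have orth: "hs_inner (purification_basis (D l) a) (purification_basis (D l) b) = (if a = b then 1 else 0)" for l a b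
    using purification_basis[OF dens[of l]] by (simp add: is_purification_basis_def)
  have "(\<Prod>l<N. hs_inner (purification_basis (D l) (Poly_Mapping.lookup i l)) (site_product [] l ** purification_basis (D l) 0))
      = (if \<forall>l<N. Poly_Mapping.lookup i l = 0 then 1 else 0)"
    by (auto simp: site_product_def orth)
  moreover have "i = 0 \<longleftrightarrow> (\<forall>l<N. Poly_Mapping.lookup i l = 0) \<and> (\<forall>l\<ge>N. Poly_Mapping.lookup i l = 0)"
    by (metis lookup_zero not_less poly_mapping_eqI)
  ultimately show ?case by (auto simp: op_id_def)
next
  case (Cons w ws)
  obtain k A where w: "w = (k, A)" by fastforce
  have k: "k < N" using Cons.prems w by auto
  let ?W = "foldr op_mult (map (\<lambda>(k,A). at_site D k A) ws) op_id"
  let ?e = "\<lambda>l. purification_basis (D l)"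
  let ?u = "\<lambda>b. Poly_Mapping.update k b i"
  let ?r = "\<Prod>l\<in>{..<N}-{k}. hs_inner (?e l (Poly_Mapping.lookup i l)) (site_product ws l ** ?e l 0)"
  let ?c = "\<forall>l\<ge>N. Poly_Mapping.lookup i l = 0"
  have inj: "inj ?u" by (rule injI) (metis lookup_update)
  have W: "?W (?u b) 0 = (if ?c then hs_inner (?e k b) (site_product ws k ** ?e k 0) * ?r else 0)" for b
  proof -
    have "(\<forall>l\<ge>N. Poly_Mapping.lookup (?u b) l = 0) = ?c" using k by (auto simp: lookup_update)
    moreover have "(\<Prod>l<N. hs_inner (?e l (Poly_Mapping.lookup (?u b) l)) (site_product ws l ** ?e l 0))
        = hs_inner (?e k b) (site_product ws k ** ?e k 0) * ?r"
      using k by (subst prod.remove[of _ k]) (auto simp: lookup_update intro!: prod.cong)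
    moreover have "fst ` set ws \<subseteq> {..<N}" using Cons.prems by auto
    note Cons.IH[OF this, of "?u b"]
    ultimately show ?thesis by (simp only:)
  qed
  \<comment> \<open>A one-site operator connects \<open>i\<close> only with the four configurations
    that agree with it away from \<open>k\<close>, so the series collapses to a sum over
    \<open>b\<close>.\<close>
  have "op_mult (at_site D k A) ?W i 0 = infsum (\<lambda>l. at_site D k A i l * ?W l 0) (range ?u)"
    unfolding op_mult_def[of "at_site D k A" ?W]
  proof (rule infsum_cong_neutral)
    fix l assume l: "l \<in> UNIV - range ?u"
    have "\<not> (\<forall>x. x \<noteq> k \<longrightarrow> Poly_Mapping.lookup i x = Poly_Mapping.lookup l x)"
    proof
      assume "\<forall>x. x \<noteq> k \<longrightarrow> Poly_Mapping.lookup i x = Poly_Mapping.lookup l x"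
      hence "l = ?u (Poly_Mapping.lookup l k)" by (intro poly_mapping_eqI) (auto simp: lookup_update)
      thus False using l by blast
    qed
    hence "at_site D k A i l = 0" by (simp only: at_site_def if_False)
    thus "at_site D k A i l * ?W l 0 = 0" by simp
  qed auto
  also have "\<dots> = (\<Sum>b\<in>UNIV. at_site D k A i (?u b) * ?W (?u b) 0)"
    using inj by (subst infsum_reindex) (auto simp: o_def)
  also have "\<dots> = (\<Sum>b\<in>UNIV. hs_inner (?e k (Poly_Mapping.lookup i k)) (A ** ?e k b) *
       (if ?c then hs_inner (?e k b) (site_product ws k ** ?e k 0) * ?r else 0))"
    by (simp add: W) (simp add: at_site_def lookup_update)
  \<comment> \<open>The adjoint moves \<open>A\<close> to the other slot, so that the sum over
    \<open>b\<close> takes the form of Parseval's identity; \<open>?r\<close> collects the other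
    sites and is free of \<open>b\<close>.\<close>
  also have "\<dots> = (if ?c then (\<Sum>b\<in>UNIV. hs_inner (dagger A ** ?e k (Poly_Mapping.lookup i k)) (?e k b) * hs_inner (?e k b) (site_product ws k ** ?e k 0)) * ?r else 0)"
  proof -
    have "(\<Sum>b\<in>UNIV. f b * (if c then h b * r else 0)) = (if c then (\<Sum>b\<in>UNIV. f b * h b) * r else 0)"
      for f h :: "4 \<Rightarrow> complex" and c r by (simp add: sum_distrib_right mult.assoc)
    thus ?thesis by (simp only: hs_inner_mult_left[of _ A])
  qed
  also have "\<dots> = (if ?c then hs_inner (?e k (Poly_Mapping.lookup i k)) (A ** site_product ws k ** ?e k 0) * ?r else 0)"
    unfolding purification_basis_complete[OF dens] 
    by (simp only: hs_inner_mult_left[of _ A, symmetric] matrix_mul_assoc)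
  also have "hs_inner (?e k (Poly_Mapping.lookup i k)) (A ** site_product ws k ** ?e k 0) * ?r
     = (\<Prod>l<N. hs_inner (?e l (Poly_Mapping.lookup i l)) (site_product (w # ws) l ** ?e l 0))"
    using k by (subst prod.remove[of _ k]) (auto simp: w site_product_def intro!: prod.cong)
  finally show ?case by (simp add: w)
qed

text \<open>Independence of the sites, now for words in which sites occur repeatedly and in any
  order.\<close>

lemma word_expectation:
  assumes dens: "\<And>k. density_matrix (D k)" and "fst ` set ws \<subseteq> {..<N}"
  shows "foldr op_mult (map (\<lambda>(k,A). at_site D k A) ws) op_id 0 0 = (\<Prod>l<N. trace (site_product ws l ** D l))"
proof -
  have "hs_inner (purification_basis (D k) 0) (A ** purification_basis (D k) 0) = trace (A ** D k)" for k A
  proof -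
    have "purification_basis (D k) 0 ** dagger (purification_basis (D k) 0) = D k"
      using purification_basis[OF dens[of k]] by (simp add: is_purification_basis_def)
    thus ?thesis by (metis hs_inner_def matrix_mul_assoc trace_mul_sym)
  qed
  thus ?thesis using word_column_zero[OF assms, where i = 0] by simp
qed

section \<open>Polarization\<close>

lemma sum_Pow_alternating:
  assumes "finite A"
  shows "(\<Sum>U\<in>Pow A. (- 1) ^ card U) = (if A = {} then 1 else (0 :: 'a :: comm_ring_1))"
  using assms
proof (induction A rule: finite_induct)
  case (insert x F)
  have "inj_on (insert x) (Pow F)" using insert.hyps by (auto simp: inj_on_def)
  hence "(\<Sum>U\<in>insert x ` Pow F. (- 1 :: 'a) ^ card U) = (\<Sum>U\<in>Pow F. (- 1) ^ card (insert x U))"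
    by (simp add: sum.reindex)
  also have "\<dots> = (\<Sum>U\<in>Pow F. - ((- 1) ^ card U))"
  proof (rule sum.cong[OF refl])
    fix U assume "U \<in> Pow F"
    hence "finite U" "x \<notin> U" using insert.hyps by (auto intro: finite_subset)
    thus "(- 1 :: 'a) ^ card (insert x U) = - ((- 1) ^ card U)" by simp
  qed
  finally have "(\<Sum>U\<in>insert x ` Pow F. (- 1 :: 'a) ^ card U) = - (\<Sum>U\<in>Pow F. (- 1) ^ card U)"
    by (simp add: sum_negf)
  thus ?case using insert.hyps by (subst Pow_insert, subst sum.union_disjoint) auto
qed simp

text \<open>Moebius inversion in the lattice of subsets; taking complements in \<open>S\<close>
  turns the interval above \<open>A\<close> into a power set.\<close>

lemma sum_supersets_alternating:
  assumes "finite S" "A \<subseteq> S"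
  shows "(\<Sum>T | A \<subseteq> T \<and> T \<subseteq> S. (- 1) ^ (card S - card T)) = (if A = S then 1 else (0 :: 'a :: comm_ring_1))"
proof -
  have "(\<Sum>T | A \<subseteq> T \<and> T \<subseteq> S. (- 1 :: 'a) ^ (card S - card T)) = (\<Sum>U\<in>Pow (S - A). (- 1) ^ card U)"
  proof (rule sum.reindex_bij_witness[of _ "\<lambda>U. S - U" "\<lambda>T. S - T"])
    fix T assume "T \<in> {T. A \<subseteq> T \<and> T \<subseteq> S}"
    thus "(- 1 :: 'a) ^ card (S - T) = (- 1) ^ (card S - card T)"
      using assms by (subst card_Diff_subset) (auto intro: finite_subset)
  qed (use assms in auto)
  also have "\<dots> = (if A = S then 1 else 0)"
    using assms by (subst sum_Pow_alternating) auto
  finally show ?thesis .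
qed

text \<open>A word of length p that uses all p letters repeats none, so it is the one-line notation
  of a permutation, extended by the identity.\<close>

lemma bij_betw_permutes_words:
  "bij_betw (\<lambda>\<pi>. map \<pi> [0..<p]) {\<pi>. \<pi> permutes {..<p}} {xs. set xs = {..<p} \<and> length xs = p}"
  unfolding bij_betw_def
proof
  show "inj_on (\<lambda>\<pi>. map \<pi> [0..<p]) {\<pi>. \<pi> permutes {..<p}}"
  proof (rule inj_onI)
    fix \<pi> \<pi>' assume a: "\<pi> \<in> {\<pi>. \<pi> permutes {..<p}}" "\<pi>' \<in> {\<pi>. \<pi> permutes {..<p}}"
      and eq: "map \<pi> [0..<p] = map \<pi>' [0..<p]"
    have "\<pi> x = \<pi>' x" for x
    proof (cases "x < p")
      case False
      thus ?thesis using a by (simp add: permutes_def)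
    qed (use eq in auto)
    thus "\<pi> = \<pi>'" by blast
  qed
  show "(\<lambda>\<pi>. map \<pi> [0..<p]) ` {\<pi>. \<pi> permutes {..<p}} = {xs. set xs = {..<p} \<and> length xs = p}"
  proof (intro equalityI subsetI)
    fix xs assume "xs \<in> (\<lambda>\<pi>. map \<pi> [0..<p]) ` {\<pi>. \<pi> permutes {..<p}}"
    thus "xs \<in> {xs. set xs = {..<p} \<and> length xs = p}"
      by (auto simp: permutes_image atLeast0LessThan simp flip: image_set)
  next
    fix xs assume "xs \<in> {xs. set xs = {..<p} \<and> length xs = p}"
    hence xs: "set xs = {..<p}" "length xs = p" by auto
    hence d: "distinct xs" by (intro card_distinct) simp
    define \<pi> where "\<pi> i = (if i < p then xs ! i else i)" for i
    have "bij_betw ((!) xs) {..<p} {..<p}" using bij_betw_nth[OF d] xs by auto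
    hence "bij_betw \<pi> {..<p} {..<p}" by (rule bij_betw_cong[THEN iffD1, rotated]) (simp add: \<pi>_def)
    hence "\<pi> permutes {..<p}" by (intro bij_imp_permutes) (auto simp: \<pi>_def)
    moreover have "xs = map \<pi> [0..<p]" by (rule nth_equalityI) (auto simp: \<pi>_def xs)
    ultimately show "xs \<in> (\<lambda>\<pi>. map \<pi> [0..<p]) ` {\<pi>. \<pi> permutes {..<p}}" by blast
  qed
qed

text \<open>Inclusion-exclusion over the set of letters that occur isolates the words in which every
  letter occurs, i.e. the permutations; no commutativity is involved.\<close>

lemma polarization:
  fixes g :: "nat list \<Rightarrow> 'a :: comm_ring_1"
  shows "(\<Sum>\<pi> | \<pi> permutes {..<p}. g (map \<pi> [0..<p])) =
     (\<Sum>T\<in>Pow {..<p}. (- 1) ^ (p - card T) * (\<Sum>xs\<in>words T p. g xs))"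
proof -
  let ?W = "words {..<p} p"
  have fin: "finite ?W" by (rule finite_lists_length_eq) simp
  have "(\<Sum>T\<in>Pow {..<p}. (- 1) ^ (p - card T) * (\<Sum>xs\<in>words T p. g xs))
     = (\<Sum>T\<in>Pow {..<p}. \<Sum>xs\<in>?W. if set xs \<subseteq> T then (- 1) ^ (p - card T) * g xs else 0)"
  proof (rule sum.cong[OF refl])
    fix T assume T: "T \<in> Pow {..<p}"
    have "words T p = {xs \<in> ?W. set xs \<subseteq> T}" using T by auto
    thus "(- 1) ^ (p - card T) * (\<Sum>xs\<in>words T p. g xs)
        = (\<Sum>xs\<in>?W. if set xs \<subseteq> T then (- 1) ^ (p - card T) * g xs else 0)"
      using fin by (simp only: sum_distrib_left sum.inter_filter) (auto intro: sum.cong)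
  qed
  also have "\<dots> = (\<Sum>xs\<in>?W. \<Sum>T\<in>Pow {..<p}. if set xs \<subseteq> T then (- 1) ^ (p - card T) * g xs else 0)"
    by (rule sum.swap)
  also have "\<dots> = (\<Sum>xs\<in>?W. if set xs = {..<p} then g xs else 0)"
  proof (rule sum.cong[OF refl])
    fix xs assume xs: "xs \<in> ?W"
    have eq: "{T \<in> Pow {..<p}. set xs \<subseteq> T} = {T. set xs \<subseteq> T \<and> T \<subseteq> {..<p}}" by auto
    have "(\<Sum>T\<in>Pow {..<p}. if set xs \<subseteq> T then (- 1) ^ (p - card T) * g xs else 0)
       = (\<Sum>T | set xs \<subseteq> T \<and> T \<subseteq> {..<p}. (- 1) ^ (card {..<p} - card T)) * g xs"
      by (simp add: sum.inter_filter[symmetric] sum_distrib_right flip: eq)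
    also have "\<dots> = (if set xs = {..<p} then g xs else 0)"
      using xs by (subst sum_supersets_alternating) auto
    finally show "(\<Sum>T\<in>Pow {..<p}. if set xs \<subseteq> T then (- 1) ^ (p - card T) * g xs else 0) = \<dots>" .
  qed
  also have "\<dots> = (\<Sum>xs | set xs = {..<p} \<and> length xs = p. g xs)"
    using fin by (subst sum.inter_filter[symmetric]) (auto intro!: sum.cong)
  also have "\<dots> = (\<Sum>\<pi> | \<pi> permutes {..<p}. g (map \<pi> [0..<p]))"
    using sum.reindex_bij_betw[OF bij_betw_permutes_words, of g p] by simp
  finally show ?thesis ..
qed

section \<open>Polarization for commuting variables\<close>

lemma power_sum_words:
  fixes x :: "'k \<Rightarrow> 'a :: comm_semiring_1"
  assumes "finite J"
  shows "(\<Sum>k\<in>J. x k) ^ p = (\<Sum>xs\<in>words J p. prod_list (map x xs))"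
proof (induction p)
  case 0
  have "words J 0 = {[]}" by auto
  thus ?case by simp
next
  case (Suc p)
  thus ?case using assms by (simp add: sum_words_Suc sum_distrib_left sum_distrib_right)
     (rule sum.swap)
qed

lemma prod_list_permuted:
  fixes x :: "'k \<Rightarrow> 'a :: comm_monoid_mult"
  assumes "\<pi> permutes {..<length w}"
  shows "prod_list (map x (permute_list \<pi> w)) = prod_list (map x w)"
proof -
  have "mset (map x (permute_list \<pi> w)) = mset (map x w)" by (simp add: mset_permute_list[OF assms])
  thus ?thesis by (metis prod_mset_prod_list)
qed

text \<open>For commuting letters all p! rearrangements have the same product. The result is the
  same combination of p-th powers, with the same coefficients, as symmetrization yields for
  operators, so both sides can be compared power by power.\<close>

lemma prod_list_polarization:
  fixes x :: "'k \<Rightarrow> 'a :: field_char_0"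
  shows "prod_list (map x w) = (\<Sum>T\<in>Pow {..<length w}.
      (- 1) ^ (length w - card T) * (\<Sum>i\<in>T. x (w ! i)) ^ length w) / fact (length w)"
proof -
  let ?p = "length w"
  have "(\<Sum>\<pi> | \<pi> permutes {..<?p}. prod_list (map (\<lambda>i. x (w ! i)) (map \<pi> [0..<?p])))
     = (\<Sum>\<pi> | \<pi> permutes {..<?p}. prod_list (map x w))"
  proof (rule sum.cong[OF refl])
    fix \<pi> assume "\<pi> \<in> {\<pi>. \<pi> permutes {..<?p}}"
    hence "prod_list (map x (permute_list \<pi> w)) = prod_list (map x w)" by (simp add: prod_list_permuted)
    thus "prod_list (map (\<lambda>i. x (w ! i)) (map \<pi> [0..<?p])) = prod_list (map x w)"
      by (simp add: permute_list_def o_def)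
  qed
  also have "\<dots> = fact ?p * prod_list (map x w)" by (simp add: card_permutations[OF refl])
  finally have "fact ?p * prod_list (map x w) = (\<Sum>T\<in>Pow {..<?p}. (- 1) ^ (?p - card T) *
       (\<Sum>xs\<in>words T ?p. prod_list (map (\<lambda>i. x (w ! i)) xs)))"
    by (simp only: polarization[where g = "\<lambda>xs. prod_list (map (\<lambda>i. x (w ! i)) xs)"])
  also have "\<dots> = (\<Sum>T\<in>Pow {..<?p}. (- 1) ^ (?p - card T) * (\<Sum>i\<in>T. x (w ! i)) ^ ?p)"
    by (intro sum.cong refl) (simp add: power_sum_words finite_subset)
  finally show ?thesis by (simp add: field_simps)
qed

section \<open>Generating functions\<close>

unbundle no vec_syntax
unbundle fps_syntax

definition egf :: "(nat \<Rightarrow> 'a :: field_char_0) \<Rightarrow> 'a fps" where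
  "egf q = Abs_fps (\<lambda>j. q j / fact j)"

lemma egf_nth [simp]: "egf q $ j = q j / fact j"
  by (simp add: egf_def)

lemma fps_deriv_egf: "fps_deriv (egf q) = egf (\<lambda>j. q (Suc j))"
  by (simp add: fps_eq_iff field_simps del: of_nat_Suc)

lemma fps_deriv_prod:
  fixes f :: "'k \<Rightarrow> 'a :: comm_ring_1 fps"
  assumes "finite J"
  shows "fps_deriv (\<Prod>l\<in>J. f l) = (\<Sum>k\<in>J. fps_deriv (f k) * (\<Prod>l\<in>J-{k}. f l))"
  using assms
proof (induction J rule: finite_induct)
  case (insert x F)
  have "(\<Prod>l\<in>insert x F - {k}. f l) = f x * (\<Prod>l\<in>F-{k}. f l)" if "k \<in> F" for k
  proof -
    have "insert x F - {k} = insert x (F - {k})" using that insert.hyps by auto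
    thus ?thesis using insert.hyps by simp
  qed
  moreover have "insert x F - {x} = F" using insert.hyps by auto
  ultimately show ?case using insert
    by (simp add: sum_distrib_left mult_ac add.commute)
qed simp

lemma fps_prod_nth_0: "(\<Prod>l\<in>J. f l) $ 0 = (\<Prod>l\<in>J. f l $ 0)"
  for f :: "'k \<Rightarrow> 'a :: comm_ring_1 fps"
  by (induction J rule: infinite_finite_induct) simp_all

text \<open>Removing the first letter \<open>k\<close> of a word shifts the sequence \<open>q k\<close>, which is differentiation of its
  exponential generating function.\<close>

lemma sum_words_prod_count:
  fixes q :: "'k \<Rightarrow> nat \<Rightarrow> 'a :: field_char_0"
  assumes "finite J"
  shows "(\<Sum>ys\<in>words J p. \<Prod>l\<in>J. q l (count_list ys l)) = fact p * (\<Prod>l\<in>J. egf (q l)) $ p"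
proof (induction p arbitrary: q)
  case 0
  have "words J 0 = {[]}" by auto
  thus ?case by (simp add: fps_prod_nth_0)
next
  case (Suc p)
  define q' where "q' k = q(k := \<lambda>j. q k (Suc j))" for k
  have "(\<Sum>ys\<in>words J (Suc p). \<Prod>l\<in>J. q l (count_list ys l))
      = (\<Sum>k\<in>J. \<Sum>ys\<in>words J p. \<Prod>l\<in>J. q' k l (count_list ys l))"
    unfolding sum_words_Suc[OF assms] by (intro sum.cong refl prod.cong) (auto simp: q'_def)
  also have "\<dots> = fact p * (\<Sum>k\<in>J. (\<Prod>l\<in>J. egf (q' k l)) $ p)"
    by (simp add: Suc sum_distrib_left)
  also have "(\<Sum>k\<in>J. (\<Prod>l\<in>J. egf (q' k l)) $ p) = fps_deriv (\<Prod>l\<in>J. egf (q l)) $ p"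
  proof -
    have "(\<Prod>l\<in>J. egf (q' k l)) = fps_deriv (egf (q k)) * (\<Prod>l\<in>J-{k}. egf (q l))" if "k \<in> J" for k
      using assms that by (subst prod.remove[of _ k]) (auto simp: q'_def fps_deriv_egf intro!: arg_cong2[where f = "(*)"] prod.cong)
    thus ?thesis by (simp add: fps_deriv_prod[OF assms] fps_sum_nth)
  qed
  finally show ?case by (simp add: algebra_simps)
qed

text \<open>The coefficients of F = exp(V x^2 / 2), read off from F' = V x F; times p! they are the
  moments of the normal law of variance V. A general field is allowed because V first arises as a
  complex sum of traces and is identified as real only later.\<close>

fun gauss_coeff :: "'a :: field \<Rightarrow> nat \<Rightarrow> 'a" where
  "gauss_coeff V 0 = 1"
| "gauss_coeff V (Suc 0) = 0"
| "gauss_coeff V (Suc (Suc p)) = V * gauss_coeff V p / of_nat (Suc (Suc p))"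

text \<open>Comparison of coefficients in (g'/g) g = g', where the constant term 1 isolates the top
  coefficient of g'/g. Coefficient j is thus a fixed polynomial in the coefficients of g up to j +
  1.\<close>

lemma fps_logderiv_nth:
  fixes g :: "complex fps"
  assumes "g $ 0 = 1"
  shows "(fps_deriv g * inverse g) $ j = of_nat (Suc j) * g $ Suc j - (\<Sum>i<j. (fps_deriv g * inverse g) $ i * g $ (j - i))"
proof -
  have "fps_deriv g * inverse g * g = fps_deriv g"
    
  proof -
    have "inverse g * g = 1" using assms by (intro inverse_mult_eq_1) simp
    thus ?thesis by (simp add: mult.assoc)
  qed
  hence "(fps_deriv g * inverse g * g) $ j = of_nat (Suc j) * g $ Suc j" by (simp only: fps_deriv_nth Suc_eq_plus1)
  also have "(fps_deriv g * inverse g * g) $ j = (\<Sum>i<j. (fps_deriv g * inverse g) $ i * g $ (j - i)) + (fps_deriv g * inverse g) $ j"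
    using assms by (simp add: fps_mult_nth[of "fps_deriv g * inverse g"] atLeast0AtMost lessThan_Suc_atMost[symmetric])
  finally show ?thesis by (simp add: algebra_simps)
qed

text \<open>By the recursion, bounds uniform in \<open>i\<close> pass from g to g'/g. A sum of such
  coefficients over the sites then grows at most linearly in the number of sites.\<close>

lemma fps_logderiv_bounded:
  fixes g :: "'i \<Rightarrow> complex fps"
  assumes g0: "\<And>i. g i $ 0 = 1" and bnd: "\<And>j. \<exists>K. \<forall>i. cmod (g i $ j) \<le> K"
  shows "\<exists>K. \<forall>i. cmod ((fps_deriv (g i) * inverse (g i)) $ j) \<le> K"
proof (induction j rule: less_induct)
  case (less j)
  obtain K where K: "\<And>j i. cmod (g i $ j) \<le> K j" using bnd by metis
  define h where "h i = fps_deriv (g i) * inverse (g i)" for i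
  have "\<forall>l. \<exists>L. l < j \<longrightarrow> (\<forall>i. cmod (h i $ l) \<le> L)" using less by (auto simp: h_def)
  then obtain L where L: "\<And>l i. l < j \<Longrightarrow> cmod (h i $ l) \<le> L l" by metis
  have "cmod (h i $ j) \<le> real (Suc j) * K (Suc j) + (\<Sum>l<j. L l * K (j - l))" for i
  proof -
    have "cmod (h i $ j) \<le> cmod (of_nat (Suc j) * g i $ Suc j) + cmod (\<Sum>l<j. h i $ l * g i $ (j - l))"
      unfolding h_def by (subst fps_logderiv_nth[OF g0]) (rule norm_triangle_ineq4)
    also have "\<dots> \<le> real (Suc j) * K (Suc j) + (\<Sum>l<j. L l * K (j - l))"
    proof (intro add_mono order_trans[OF norm_sum] sum_mono)
      show "cmod (of_nat (Suc j) * g i $ Suc j) \<le> real (Suc j) * K (Suc j)"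
        using K by (simp only: norm_mult norm_of_nat) (intro mult_left_mono, auto)
      fix l assume "l \<in> {..<j}"
      hence "cmod (h i $ l) \<le> L l" using L by simp
      moreover have "0 \<le> L l" using calculation norm_ge_zero order_trans by blast
      ultimately show "cmod (h i $ l * g i $ (j - l)) \<le> L l * K (j - l)"
        using K by (auto simp: norm_mult intro!: mult_mono)
    qed
    finally show ?thesis .
  qed
  thus ?case unfolding h_def by blast
qed

text \<open>A central limit theorem for the coefficients of products of power series: with
  \<open>H = \<Sum> g' / g\<close>, the product \<open>F\<close> satisfies \<open>F' = F H\<close>, and after rescaling the only coefficient of
  \<open>H\<close> that survives in the limit is the linear one.\<close>

lemma fps_prod_clt:
  fixes g :: "nat \<Rightarrow> nat \<Rightarrow> complex fps" and N :: "nat \<Rightarrow> nat"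
  assumes g0: "\<And>n k. g n k $ 0 = 1" and bnd: "\<And>j. \<exists>K. \<forall>n k. cmod (g n k $ j) \<le> K"
    and N: "\<And>n. real (N n) \<le> c * real n"
    and m1: "(\<lambda>n. (\<Sum>k<N n. g n k $ 1) / of_real (sqrt (real n))) \<longlonglongrightarrow> 0"
    and m2: "(\<lambda>n. (\<Sum>k<N n. 2 * g n k $ 2 - (g n k $ 1)\<^sup>2) / of_nat n) \<longlonglongrightarrow> V"
  shows "(\<lambda>n. (\<Prod>k<N n. g n k) $ p / of_real (sqrt (real n)) ^ p) \<longlonglongrightarrow> gauss_coeff V p"
proof -
  define s where "s n = complex_of_real (sqrt (real n))" for n
  define h where "h n k = fps_deriv (g n k) * inverse (g n k)" for n k
  define H where "H n = (\<Sum>k<N n. h n k)" for n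
  define F where "F n = (\<Prod>k<N n. g n k)" for n
  have F': "fps_deriv (F n) = F n * H n" for n
  proof -
    have "fps_deriv (g n k) * (\<Prod>l\<in>{..<N n}-{k}. g n l) = F n * h n k" if "k < N n" for k
    proof -
      have "F n * h n k = fps_deriv (g n k) * (\<Prod>l\<in>{..<N n}-{k}. g n l) * (inverse (g n k) * g n k)"
        using that by (simp add: F_def h_def prod.remove[of _ k] mult_ac)
      thus ?thesis using g0 by (simp add: inverse_mult_eq_1)
    qed
    thus ?thesis unfolding F_def[of n] by (subst fps_deriv_prod) (auto simp: H_def sum_distrib_left F_def)
  qed
  \<comment> \<open>Splitting the normalization as s^i s^(q-i+1) assigns s^(j+1) to coefficient j of
    \<open>H\<close>. For n = 0 both sides are 0, by division by zero.\<close>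
  have rec: "F n $ Suc q / s n ^ Suc q
     = (\<Sum>i=0..q. (F n $ i / s n ^ i) * (H n $ (q - i) / s n ^ Suc (q - i))) / of_nat (Suc q)" for n q
  proof -
    have "of_nat (Suc q) * F n $ Suc q = (F n * H n) $ q" unfolding F'[symmetric] by simp
    hence "F n $ Suc q / s n ^ Suc q = (\<Sum>i=0..q. F n $ i * H n $ (q - i)) / s n ^ Suc q / of_nat (Suc q)"
      by (simp only: fps_mult_nth[symmetric] divide_divide_eq_left mult.commute[of "s n ^ Suc q"])
        (metis nonzero_mult_divide_mult_cancel_left of_nat_neq_0)
    also have "(\<Sum>i=0..q. F n $ i * H n $ (q - i)) / s n ^ Suc q
       = (\<Sum>i=0..q. (F n $ i / s n ^ i) * (H n $ (q - i) / s n ^ Suc (q - i)))"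
      unfolding sum_divide_distrib
    proof (intro sum.cong refl)
      fix i assume "i \<in> {0..q}"
      hence "s n ^ Suc q = s n ^ i * s n ^ Suc (q - i)" by (simp flip: power_add)
      thus "F n $ i * H n $ (q - i) / s n ^ Suc q = (F n $ i / s n ^ i) * (H n $ (q - i) / s n ^ Suc (q - i))"
        by (simp only: times_divide_times_eq)
    qed
    finally show ?thesis .
  qed
  \<comment> \<open>Coefficient j is O(n) and is divided by n^((j+1)/2). This settles j at least 2,
    already with the exponent 3/2; the cases 0 and 1 are the assumptions \<open>m1\<close> and
    \<open>m2\<close>.\<close>
  have Hlim: "(\<lambda>n. H n $ j / s n ^ Suc j) \<longlonglongrightarrow> (if j = 1 then V else 0)" for j
  proof -
    have h0: "h n k $ 0 = g n k $ 1" for n k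
      unfolding h_def by (subst fps_logderiv_nth[OF g0]) simp
    consider "j = 0" | "j = 1" | "j \<ge> 2" by linarith
    thus ?thesis
    proof cases
      case 1
      thus ?thesis using m1 by (simp add: H_def fps_sum_nth h0 s_def)
    next
      case 2
      \<comment> \<open>For a moment generating function this is the second cumulant, that is, the
        variance of one site.\<close>
      have "h n k $ 1 = 2 * g n k $ 2 - (g n k $ 1)\<^sup>2" for n k
        unfolding h_def by (subst fps_logderiv_nth[OF g0])
          (simp add: h0[unfolded h_def] g0 power2_eq_square numeral_2_eq_2)
      moreover have "s n ^ Suc 1 = of_nat n" for n
        by (simp add: s_def flip: of_real_mult)
      ultimately show ?thesis using m2 2 by (simp only: H_def fps_sum_nth) simp
    next
      case 3
      obtain K where K: "\<And>n k. cmod (h n k $ j) \<le> K"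
        using fps_logderiv_bounded[of "\<lambda>(n,k). g n k" j] g0 bnd by (auto simp: h_def)
      have "0 \<le> K" using K norm_ge_zero order_trans by blast
      have "cmod (H n $ j / s n ^ Suc j) \<le> c * K * (1 / sqrt (real n))" for n
      proof (cases "n = 0")
        case True
        thus ?thesis by (simp add: s_def)
      next
        case False
        have "cmod (H n $ j) \<le> (\<Sum>k<N n. K)"
          unfolding H_def fps_sum_nth using K by (intro order_trans[OF norm_sum] sum_mono) auto
        also have "\<dots> \<le> c * real n * K" using mult_right_mono[OF N \<open>0 \<le> K\<close>] by simp
        finally have 1: "cmod (H n $ j) \<le> c * K * real n" by (simp add: mult_ac)
        have sq: "1 \<le> sqrt (real n)" using False by simp
        have 2: "sqrt (real n) ^ 3 \<le> sqrt (real n) ^ Suc j"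
          using 3 sq by (intro power_increasing) auto
        have "cmod (H n $ j / s n ^ Suc j) = cmod (H n $ j) / sqrt (real n) ^ Suc j"
          by (simp add: s_def norm_divide norm_mult norm_power)
        also have "\<dots> \<le> (c * K * real n) / sqrt (real n) ^ 3"
          using 1 2 sq by (intro frac_le) (auto intro: order_trans[OF norm_ge_zero])
        also have "\<dots> = c * K * (1 / sqrt (real n))"
        proof -
          have "sqrt (real n) ^ 3 = real n * sqrt (real n)" by (simp add: eval_nat_numeral)
          thus ?thesis using False by simp
        qed
        finally show ?thesis .
      qed
      moreover have "(\<lambda>n. c * K * (1 / sqrt (real n))) \<longlonglongrightarrow> 0"
        by real_asymp
      ultimately show ?thesis using 3 
        by (auto intro: Lim_null_comparison[rotated] always_eventually)
    qed
  qed
  have "(\<lambda>n. F n $ p / s n ^ p) \<longlonglongrightarrow> gauss_coeff V p"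
  proof (induction p rule: less_induct)
    case (less p)
    show ?case
    proof (cases p)
      case 0
      thus ?thesis by (simp add: F_def fps_prod_nth_0 g0)
    next
      case (Suc q)
      have "(\<lambda>n. F n $ Suc q / s n ^ Suc q) \<longlonglongrightarrow>
         (\<Sum>i=0..q. gauss_coeff V i * (if q - i = 1 then V else 0)) / of_nat (Suc q)"
        unfolding rec using less Suc
        by (intro tendsto_divide tendsto_sum tendsto_mult Hlim) (auto simp del: of_nat_Suc)
      also have "(\<Sum>i=0..q. gauss_coeff V i * (if q - i = 1 then V else 0)) / of_nat (Suc q) = gauss_coeff V (Suc q)"
      proof (cases q)
        case (Suc r)
        have "(\<Sum>i=0..q. gauss_coeff V i * (if q - i = 1 then V else 0))
            = (\<Sum>i=0..q. if i = r then gauss_coeff V r * V else 0)"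
          using Suc by (intro sum.cong) auto
        thus ?thesis using Suc by (simp add: mult.commute)
      qed simp
      finally show ?thesis using Suc by simp
    qed
  qed
  thus ?thesis by (simp add: F_def s_def)
qed
unbundle no fps_syntax
unbundle vec_syntax

section \<open>Gaussian moments\<close>

lemma gauss_coeff_even:
  "gauss_coeff (V :: 'a :: field_char_0) (2 * k) = V ^ k / (2 ^ k * fact k)"
proof (induction k)
  case (Suc k)
  have "gauss_coeff V (2 * Suc k) = V * gauss_coeff V (2 * k) / of_nat (Suc (Suc (2 * k)))"
    by simp
  also have "(of_nat (Suc (Suc (2 * k))) :: 'a) = 2 * of_nat (Suc k)" by simp
  finally have step: "gauss_coeff V (2 * Suc k) = V * gauss_coeff V (2 * k) / (2 * of_nat (Suc k))" .
  show ?case unfolding step Suc by (simp add: field_simps del: of_nat_Suc)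
qed simp

lemma gauss_coeff_odd: "gauss_coeff V (2 * k + 1) = 0"
  by (induction k) simp_all

lemma gauss_coeff_of_real: "gauss_coeff (complex_of_real V) p = complex_of_real (gauss_coeff V p)"
  by (induction V p rule: gauss_coeff.induct) simp_all

lemma gauss_coeff_zero: "gauss_coeff 0 p = (if p = 0 then 1 else 0)"
  by (cases "(0 :: 'a :: field, p)" rule: gauss_coeff.cases) simp_all

text \<open>Expressing the variance as the second moment gives one formula for the normal density
  and for the degenerate case, in which it vanishes.\<close>

lemma (in prob_space)
  assumes "centered_gaussian X"
  shows integrable_centered_gaussian_power: "integrable M (\<lambda>w. X w ^ p)"
    and expectation_centered_gaussian_power:
      "expectation (\<lambda>w. X w ^ p) = fact p * gauss_coeff (expectation (\<lambda>w. (X w)\<^sup>2)) p"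
proof -
  have X [measurable]: "X \<in> borel_measurable M" using assms by (simp add: centered_gaussian_def)
  consider "AE w in M. X w = 0" | s where "s > 0" "distributed M lborel X (normal_density 0 s)"
    using assms unfolding centered_gaussian_def by blast
  hence "integrable M (\<lambda>w. X w ^ p) \<and>
    expectation (\<lambda>w. X w ^ p) = fact p * gauss_coeff (expectation (\<lambda>w. (X w)\<^sup>2)) p"
  proof cases
    case 1
    \<comment> \<open>Keeping \<open>0 ^ q\<close> unevaluated covers the exponent 0, where it
      equals 1.\<close>
    have int: "expectation (\<lambda>w. X w ^ q) = expectation (\<lambda>w. 0 ^ q)" for q
      by (rule integral_cong_AE) (use 1 in auto)
    have "integrable M (\<lambda>w. X w ^ p) \<longleftrightarrow> integrable M (\<lambda>w. 0 ^ p :: real)"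
      by (rule integrable_cong_AE) (use 1 in auto)
    thus ?thesis by (simp add: int gauss_coeff_zero prob_space)
  next
    case (2 s)
    have int: "expectation (\<lambda>w. X w ^ q) = (\<integral>x. normal_density 0 s x * x ^ q \<partial>lborel)" for q
      by (rule distributed_integral[symmetric, OF 2(2)]) auto
    have ev: "expectation (\<lambda>w. X w ^ (2 * k)) = fact (2 * k) / ((2 / s\<^sup>2) ^ k * fact k)" for k
      unfolding int using integral_normal_moment_even[OF 2(1), of 0 k] by simp
    have od: "expectation (\<lambda>w. X w ^ (2 * k + 1)) = 0" for k
      unfolding int using integral_normal_moment_odd[OF 2(1), of 0 k] by simp
    have var: "expectation (\<lambda>w. (X w)\<^sup>2) = s\<^sup>2" using ev[of 1] by simp
    have "integrable M (\<lambda>w. X w ^ p)"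
      using integrable_normal_moment[OF 2(1), of 0 p]
      by (subst distributed_integrable[symmetric, OF 2(2)]) auto
    moreover have "expectation (\<lambda>w. X w ^ p) = fact p * gauss_coeff (s\<^sup>2) p"
    proof (cases "even p")
      case True
      then obtain k where "p = 2 * k" by blast
      thus ?thesis using ev[of k] by (simp add: gauss_coeff_even power_divide)
    next
      case False
      then obtain k where "p = 2 * k + 1" by (rule oddE)
      thus ?thesis using od[of k] gauss_coeff_odd[of "s\<^sup>2" k] by simp
    qed
    ultimately show ?thesis using var by simp
  qed
  thus "integrable M (\<lambda>w. X w ^ p)"
    "expectation (\<lambda>w. X w ^ p) = fact p * gauss_coeff (expectation (\<lambda>w. (X w)\<^sup>2)) p" by auto
qed

lemma (in prob_space) integrable_centered_gaussian_mult:
  assumes "centered_gaussian X" "centered_gaussian Y"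
  shows "integrable M (\<lambda>w. X w * Y w)"
proof (rule Bochner_Integration.integrable_bound)
  show "integrable M (\<lambda>w. (X w)\<^sup>2 + (Y w)\<^sup>2)"
    using assms by (intro Bochner_Integration.integrable_add integrable_centered_gaussian_power)
  show "(\<lambda>w. X w * Y w) \<in> borel_measurable M"
    using assms by (intro borel_measurable_times) (auto simp: centered_gaussian_def)
  have "\<bar>x * y\<bar> \<le> x\<^sup>2 + y\<^sup>2" for x y :: real
    using sum_squares_bound[of "\<bar>x\<bar>" "\<bar>y\<bar>"] abs_ge_zero[of "x * y"] unfolding abs_mult power2_abs by linarith
  thus "AE w in M. norm (X w * Y w) \<le> norm ((X w)\<^sup>2 + (Y w)\<^sup>2)" by simp
qed

section \<open>Covariances and moments of linear forms of the Brownian motion\<close>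

context centered_brownian_motion_3d
begin

text \<open>The assumption \<open>gaussian\<close> attaches one coefficient vector to each time. A
  word may contain several letters with the same time, so \<open>\<tau>\<close> need not be
  injective and the unit vectors are collected over its fibres.\<close>

lemma centered_gaussian_sum:
  assumes J: "finite J" "\<And>i. i \<in> J \<Longrightarrow> 0 \<le> \<tau> i"
  shows "centered_gaussian (\<lambda>w. \<Sum>i\<in>J. B (\<tau> i) w $ a i)"
proof -
  have "(\<Sum>i\<in>J. B (\<tau> i) w $ a i) = (\<Sum>t\<in>\<tau> ` J. (\<Sum>i | i \<in> J \<and> \<tau> i = t. axis (a i) 1) \<bullet> B t w)" for w
  proof -
    have "(\<Sum>t\<in>\<tau> ` J. (\<Sum>i | i \<in> J \<and> \<tau> i = t. axis (a i) 1) \<bullet> B t w)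
        = (\<Sum>t\<in>\<tau> ` J. \<Sum>i | i \<in> J \<and> \<tau> i = t. B (\<tau> i) w $ a i)"
      by (intro sum.cong refl) (simp add: inner_sum_left inner_axis')
    thus ?thesis using J(1) sum.image_gen[of J "\<lambda>i. B (\<tau> i) w $ a i" \<tau>] by simp
  qed
  thus ?thesis using J by (simp only:) (intro gaussian, auto)
qed

lemma centered_gaussian_component: "0 \<le> t \<Longrightarrow> centered_gaussian (\<lambda>w. B t w $ a)"
  using centered_gaussian_sum[of "{()}" "\<lambda>_. t" "\<lambda>_. a"] by simp

lemma expectation_component: "0 \<le> t \<Longrightarrow> expectation (\<lambda>w. B t w $ a) = 0"
  using expectation_centered_gaussian_power[OF centered_gaussian_component, of t a 1] by simp

lemma integrable_component: "0 \<le> t \<Longrightarrow> integrable M (\<lambda>w. B t w $ a)"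
  using integrable_centered_gaussian_power[OF centered_gaussian_component, of t a 1] by simp

lemma integrable_component_mult:
  "0 \<le> s \<Longrightarrow> 0 \<le> t \<Longrightarrow> integrable M (\<lambda>w. B s w $ a * B t w $ b)"
  by (intro integrable_centered_gaussian_mult centered_gaussian_component)

text \<open>The increment after s is independent of the one before s and has mean 0, so B at time t
  may be replaced by B at time s.\<close>

lemma covariance_le:
  assumes "0 \<le> s" "s \<le> t"
  shows "expectation (\<lambda>w. B s w $ a * B t w $ b) = C $ a $ b * s"
proof -
  \<comment> \<open>The partition 0, s, t. \<open>B 0\<close> vanishes only almost everywhere, hence
    the increments are compared with \<open>B s\<close> almost everywhere below.\<close>
  define u where "u i = (if i = 0 then 0 else if i = 1 then s else t)" for i :: nat
  define Y where "Y i w = (B (u (Suc i)) w - B (u i) w) $ (if i = 0 then a else b)" for i w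
  have "indep_vars (\<lambda>_. borel) (\<lambda>i w. B (u (Suc i)) w - B (u i) w) {..<2}"
    using assms by (intro independent_increments) (auto simp: u_def)
  hence ind: "indep_vars (\<lambda>_. borel) Y {..<2}"
    unfolding Y_def by (rule indep_vars_compose2) simp
  have "integrable M (Y i)" for i
    using assms unfolding Y_def by (auto simp: u_def intro!: Bochner_Integration.integrable_diff integrable_component)
  hence "expectation (\<lambda>w. \<Prod>i<2. Y i w) = (\<Prod>i<2. expectation (Y i))"
    by (intro indep_vars_lebesgue_integral ind) auto
  moreover have "expectation (Y 0) = 0"
    unfolding Y_def using assms by (simp add: u_def expectation_component integrable_component)
  ultimately have 0: "expectation (\<lambda>w. Y 0 w * Y 1 w) = 0" by (simp add: numeral_2_eq_2)
  have [measurable]: "B r \<in> borel_measurable M" if "0 \<le> r" for r using random_vector that .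
  have "expectation (\<lambda>w. Y 0 w * Y 1 w) = expectation (\<lambda>w. B s w $ a * B t w $ b - B s w $ a * B s w $ b)"
  proof (rule integral_cong_AE)
    show "(\<lambda>w. B s w $ a * B t w $ b - B s w $ a * B s w $ b) \<in> borel_measurable M"
      using assms by (intro borel_measurable_integrable Bochner_Integration.integrable_diff integrable_component_mult) auto
    show "(\<lambda>w. Y 0 w * Y 1 w) \<in> borel_measurable M"
      using \<open>\<And>i. integrable M (Y i)\<close> by (intro borel_measurable_times) auto
    show "AE w in M. Y 0 w * Y 1 w = B s w $ a * B t w $ b - B s w $ a * B s w $ b"
      using start by eventually_elim (simp add: Y_def u_def algebra_simps)
  qed
  also have "\<dots> = expectation (\<lambda>w. B s w $ a * B t w $ b) - expectation (\<lambda>w. B s w $ a * B s w $ b)"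
    using assms by (intro Bochner_Integration.integral_diff integrable_component_mult) auto
  finally show ?thesis using 0 covariance[OF assms(1)] by simp
qed

lemma covariance_symmetric: "C $ a $ b = C $ b $ a"
  using covariance[of 1 a b] covariance[of 1 b a] by (simp add: mult.commute)

lemma covariance_min:
  assumes "0 \<le> s" "0 \<le> t"
  shows "expectation (\<lambda>w. B s w $ a * B t w $ b) = C $ a $ b * min s t"
  using covariance_le[of s t a b] covariance_le[of t s b a] covariance_symmetric[of a b] assms
  by (cases "s \<le> t") (simp_all add: mult.commute)

lemma moments_of_sum:
  assumes J: "finite J" "\<And>i. i \<in> J \<Longrightarrow> 0 \<le> \<tau> i"
  shows "expectation (\<lambda>w. (\<Sum>i\<in>J. B (\<tau> i) w $ a i) ^ p) =
    fact p * gauss_coeff (\<Sum>i\<in>J. \<Sum>j\<in>J. C $ a i $ a j * min (\<tau> i) (\<tau> j)) p"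
proof -
  have "expectation (\<lambda>w. (\<Sum>i\<in>J. B (\<tau> i) w $ a i)\<^sup>2) =
      (\<Sum>i\<in>J. \<Sum>j\<in>J. C $ a i $ a j * min (\<tau> i) (\<tau> j))"
  proof -
    have "expectation (\<lambda>w. (\<Sum>i\<in>J. B (\<tau> i) w $ a i)\<^sup>2) =
        expectation (\<lambda>w. \<Sum>i\<in>J. \<Sum>j\<in>J. B (\<tau> i) w $ a i * B (\<tau> j) w $ a j)"
      by (simp only: power2_eq_square sum_product)
    also have "\<dots> = (\<Sum>i\<in>J. expectation (\<lambda>w. \<Sum>j\<in>J. B (\<tau> i) w $ a i * B (\<tau> j) w $ a j))"
      using J by (intro Bochner_Integration.integral_sum Bochner_Integration.integrable_sum integrable_component_mult)
    also have "\<dots> = (\<Sum>i\<in>J. \<Sum>j\<in>J. expectation (\<lambda>w. B (\<tau> i) w $ a i * B (\<tau> j) w $ a j))"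
      using J by (intro sum.cong refl Bochner_Integration.integral_sum integrable_component_mult)
    also have "\<dots> = (\<Sum>i\<in>J. \<Sum>j\<in>J. C $ a i $ a j * min (\<tau> i) (\<tau> j))"
      using J by (intro sum.cong refl covariance_min)
    finally show ?thesis .
  qed
  thus ?thesis using expectation_centered_gaussian_power[OF centered_gaussian_sum[of J \<tau> a, OF J], of p]
    by (simp only:)
qed

lemma integrable_sum_power:
  assumes J: "finite J" "\<And>i. i \<in> J \<Longrightarrow> 0 \<le> \<tau> i"
  shows "integrable M (\<lambda>w. (\<Sum>i\<in>J. B (\<tau> i) w $ a i) ^ p)"
  using J by (intro integrable_centered_gaussian_power centered_gaussian_sum)

end

section \<open>Cesaro means\<close>

text \<open>The common core of the two averaging statements. Smallness relative to
  \<open>\<phi>\<close> is stated additively, which remains meaningful when \<open>\<phi> N\<close>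
  is 0, as happens at time 0.\<close>

lemma null_of_small_growth:
  fixes s \<phi> \<psi> :: "nat \<Rightarrow> real"
  assumes s: "\<And>N. 0 \<le> s N" and growth: "\<And>\<epsilon>. 0 < \<epsilon> \<Longrightarrow> \<exists>S. \<forall>N. s N \<le> S + \<epsilon> * \<phi> N"
    and N: "\<And>n. \<phi> (N n) \<le> K * \<psi> n" and \<psi>: "filterlim \<psi> at_top sequentially"
  shows "(\<lambda>n. s (N n) / \<psi> n) \<longlonglongrightarrow> 0"
proof (rule tendstoI)
  fix e :: real assume e: "0 < e"
  \<comment> \<open>The summand 1 and the absolute value make this positive for every real
    \<open>K\<close>.\<close>
  define \<epsilon> where "\<epsilon> = e / (2 * (\<bar>K\<bar> + 1))"
  have \<epsilon>: "0 < \<epsilon>" using e by (simp add: \<epsilon>_def)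
  have "\<epsilon> * K < \<epsilon> * (\<bar>K\<bar> + 1)" using \<epsilon> by (intro mult_strict_left_mono) auto
  also have "\<dots> = e / 2" by (simp add: \<epsilon>_def field_simps)
  finally have \<epsilon>K: "\<epsilon> * K < e / 2" .
  obtain S where S: "\<And>N. s N \<le> S + \<epsilon> * \<phi> N" using growth[OF \<epsilon>] by blast
  have "(\<lambda>n. S / \<psi> n) \<longlonglongrightarrow> 0" using \<psi> by (intro tendsto_divide_0[OF tendsto_const] filterlim_at_top_imp_at_infinity)
  hence "\<forall>\<^sub>F n in sequentially. S / \<psi> n < e / 2" by (rule order_tendstoD) (use e in simp)
  moreover have "\<forall>\<^sub>F n in sequentially. \<psi> n > 0" using \<psi> by (simp add: filterlim_at_top_dense)
  ultimately show "\<forall>\<^sub>F n in sequentially. dist (s (N n) / \<psi> n) 0 < e"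
  proof eventually_elim
    case (elim n)
    have "s (N n) \<le> S + \<epsilon> * (K * \<psi> n)"
      using S[of "N n"] mult_left_mono[OF N, of \<epsilon> n] \<epsilon> by linarith
    hence "s (N n) / \<psi> n \<le> (S + \<epsilon> * (K * \<psi> n)) / \<psi> n" using elim by (intro divide_right_mono) auto
    also have "\<dots> = S / \<psi> n + \<epsilon> * K" using elim by (simp add: field_simps)
    finally have "s (N n) / \<psi> n < e" using elim \<epsilon>K by linarith
    moreover have "0 \<le> s (N n) / \<psi> n" using elim s by simp
    ultimately show ?case by (simp add: dist_real_def)
  qed
qed

lemma nat_floor_mult_le: "0 \<le> t \<Longrightarrow> real (nat \<lfloor>real n * t\<rfloor>) \<le> t * real n"
  by (simp add: mult.commute)

text \<open>The increments of \<open>\<phi>\<close> telescope; the finitely many indices below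
  \<open>k0\<close> are absorbed into the constant.\<close>

lemma sum_growth:
  fixes b \<phi> :: "nat \<Rightarrow> real"
  assumes b: "\<And>k. 0 \<le> b k" and \<phi>: "\<And>k. 0 \<le> \<phi> k"
    and step: "\<And>k. k0 \<le> k \<Longrightarrow> b k \<le> \<phi> (Suc k) - \<phi> k"
  shows "(\<Sum>k<N. b k) \<le> (\<Sum>k<k0. b k) + \<phi> N"
proof (cases "N \<le> k0")
  case True
  hence "(\<Sum>k<N. b k) \<le> (\<Sum>k<k0. b k)" using b by (intro sum_mono2) auto
  thus ?thesis using \<phi>[of N] by linarith
next
  case False
  hence "k0 \<le> N" by simp
  thus ?thesis
  proof (induction N rule: dec_induct)
    case (step n)
    thus ?case using assms(3)[of n] by simp
  qed (use \<phi> in simp)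
qed

text \<open>1/sqrt k is at most three times the increment of sqrt at k, because sqrt(k+1) + sqrt k
  is at most 3 sqrt k. So terms of size o(k^(-1/2)) have partial sums of size o(n^(1/2)).\<close>

lemma sum_smallo_inverse_sqrt:
  fixes b :: "nat \<Rightarrow> real"
  assumes b: "\<And>k. 0 \<le> b k" and small: "b \<in> o(\<lambda>n. 1 / sqrt (real n))" and t: "0 \<le> t"
  shows "(\<lambda>n. (\<Sum>k<nat \<lfloor>real n * t\<rfloor>. b k) / sqrt (real n)) \<longlonglongrightarrow> 0"
proof (rule null_of_small_growth[where s = "\<lambda>N. \<Sum>k<N. b k" and \<phi> = "\<lambda>N. sqrt (real N)" and K = "sqrt t"])
  fix \<epsilon> :: real assume \<epsilon>: "0 < \<epsilon>"
  have "\<forall>\<^sub>F k in sequentially. b k \<le> \<epsilon> / 3 * (1 / sqrt (real k))"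
    using landau_o.smallD[OF small, of "\<epsilon> / 3"] \<epsilon> b by (auto elim: eventually_mono)
  then obtain k1 where k1: "\<And>k. k1 \<le> k \<Longrightarrow> b k \<le> \<epsilon> / 3 * (1 / sqrt (real k))"
    by (auto simp: eventually_sequentially)
  \<comment> \<open>Starting at \<open>Suc k1\<close> keeps k positive, as the comparison with sqrt
    requires.\<close>
  have "(\<Sum>k<N. b k) \<le> (\<Sum>k<Suc k1. b k) + \<epsilon> * sqrt (real N)" for N
  proof (rule sum_growth[OF b])
    fix k assume k: "Suc k1 \<le> k"
    have "sqrt (real (Suc k)) \<le> sqrt (4 * real k)" using k by (intro real_sqrt_le_mono) simp
    hence "sqrt (real (Suc k)) + sqrt (real k) \<le> 3 * sqrt (real k)" by (simp add: real_sqrt_mult)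
    moreover have "(sqrt (real (Suc k)) - sqrt (real k)) * (sqrt (real (Suc k)) + sqrt (real k)) = 1"
      by (simp add: algebra_simps)
    moreover have pos: "0 < sqrt (real k)" using k by simp
    ultimately have "1 \<le> (sqrt (real (Suc k)) - sqrt (real k)) * (3 * sqrt (real k))"
      by (metis diff_ge_0_iff_ge mult_left_mono of_nat_mono le_SucI order_refl real_sqrt_le_iff)
    hence "1 / (3 * sqrt (real k)) \<le> sqrt (real (Suc k)) - sqrt (real k)"
      using pos by (simp add: divide_le_eq)
    hence "\<epsilon> * (1 / (3 * sqrt (real k))) \<le> \<epsilon> * (sqrt (real (Suc k)) - sqrt (real k))"
      using \<epsilon> by (intro mult_left_mono) auto
    thus "b k \<le> \<epsilon> * sqrt (real (Suc k)) - \<epsilon> * sqrt (real k)"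
      using k1[of k] k by (simp add: right_diff_distrib)
  qed (use \<epsilon> in simp)
  thus "\<exists>S. \<forall>N. (\<Sum>k<N. b k) \<le> S + \<epsilon> * sqrt (real N)" by blast
next
  fix n
  have "sqrt (real (nat \<lfloor>real n * t\<rfloor>)) \<le> sqrt (t * real n)"
    using nat_floor_mult_le[OF t] by (rule real_sqrt_le_mono)
  thus "sqrt (real (nat \<lfloor>real n * t\<rfloor>)) \<le> sqrt t * sqrt (real n)" by (simp add: real_sqrt_mult)
next
  show "filterlim (\<lambda>n. sqrt (real n)) at_top sequentially" by real_asymp
qed (use b in \<open>auto intro: sum_nonneg\<close>)

lemma cesaro_null:
  fixes b :: "nat \<Rightarrow> real"
  assumes b: "\<And>k. 0 \<le> b k" and lim: "b \<longlonglongrightarrow> 0" and t: "0 \<le> t"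
  shows "(\<lambda>n. (\<Sum>k<nat \<lfloor>real n * t\<rfloor>. b k) / real n) \<longlonglongrightarrow> 0"
proof (rule null_of_small_growth[where s = "\<lambda>N. \<Sum>k<N. b k" and \<phi> = real and K = t])
  fix \<epsilon> :: real assume \<epsilon>: "0 < \<epsilon>"
  then obtain k1 where k1: "\<And>k. k1 \<le> k \<Longrightarrow> b k < \<epsilon>"
    using order_tendstoD(2)[OF lim] by (auto simp: eventually_sequentially)
  have "(\<Sum>k<N. b k) \<le> (\<Sum>k<k1. b k) + \<epsilon> * real N" for N
    by (rule sum_growth[OF b]) (use k1 \<epsilon> in \<open>auto simp: algebra_simps intro: less_imp_le\<close>)
  thus "\<exists>S. \<forall>N. (\<Sum>k<N. b k) \<le> S + \<epsilon> * real N" by blast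
qed (use b nat_floor_mult_le[OF t] filterlim_real_sequentially in \<open>auto intro: sum_nonneg\<close>)

lemma cesaro:
  fixes b :: "nat \<Rightarrow> complex"
  assumes lim: "b \<longlonglongrightarrow> L" and t: "0 \<le> t"
  shows "(\<lambda>n. (\<Sum>k<nat \<lfloor>real n * t\<rfloor>. b k) / of_nat n) \<longlonglongrightarrow> of_real t * L"
proof -
  let ?N = "\<lambda>n. nat \<lfloor>real n * t\<rfloor>"
  have "(\<lambda>n. (\<Sum>k<?N n. cmod (b k - L)) / real n) \<longlonglongrightarrow> 0"
    using lim by (intro cesaro_null t) (auto simp: LIM_zero_iff tendsto_norm_zero_iff)
  hence 1: "(\<lambda>n. (\<Sum>k<?N n. b k - L) / of_nat n) \<longlonglongrightarrow> 0"
    by (rule Lim_null_comparison[rotated])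
      (auto simp: norm_divide intro!: always_eventually divide_right_mono norm_sum)
  have "(\<lambda>n. real (?N n) / real n) \<longlonglongrightarrow> t"
  proof (rule tendsto_sandwich)
    show "\<forall>\<^sub>F n in sequentially. t - 1 / real n \<le> real (?N n) / real n"
      using eventually_gt_at_top[of 0]
    proof eventually_elim
      case (elim n)
      have "real n * t - 1 \<le> real (?N n)" by linarith
      hence "(real n * t - 1) / real n \<le> real (?N n) / real n" by (rule divide_right_mono) simp
      thus ?case using elim by (simp add: diff_divide_distrib)
    qed
    show "\<forall>\<^sub>F n in sequentially. real (?N n) / real n \<le> t"
      using eventually_gt_at_top[of 0]
      by eventually_elim (use nat_floor_mult_le[OF t] in \<open>auto simp: divide_le_eq\<close>)
    show "(\<lambda>n. t - 1 / real n) \<longlonglongrightarrow> t" by real_asymp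
  qed simp
  hence "(\<lambda>n. complex_of_real (real (?N n) / real n)) \<longlonglongrightarrow> of_real t" by (rule tendsto_of_real)
  hence 2: "(\<lambda>n. complex_of_real (real (?N n) / real n) * L) \<longlonglongrightarrow> of_real t * L"
    by (rule tendsto_mult_right)
  have "(\<Sum>k<?N n. b k) / of_nat n = (\<Sum>k<?N n. b k - L) / of_nat n + complex_of_real (real (?N n) / real n) * L" for n
    by (simp add: sum_subtractf diff_divide_distrib)
  thus ?thesis using tendsto_add[OF 1 2] by simp
qed

section \<open>Moments of linear combinations\<close>

lemma matrix_sum_mult_right: "(\<Sum>x\<in>J. A x) ** B = (\<Sum>x\<in>J. A x ** B)"
  for B :: "'a :: comm_ring_1^'n^'m"
  by (auto simp: vec_eq_iff matrix_matrix_mult_def sum_distrib_right intro: sum.swap)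

lemma matrix_sum_mult_left: "B ** (\<Sum>x\<in>J. A x) = (\<Sum>x\<in>J. B ** A x)"
  for B :: "'a :: comm_ring_1^'n^'m"
  by (auto simp: vec_eq_iff matrix_matrix_mult_def sum_distrib_left intro: sum.swap)

lemma trace_sum: "trace (\<Sum>x\<in>J. A x) = (\<Sum>x\<in>J. trace (A x))"
  by (auto simp: trace_def intro: sum.swap)

lemma at_site_sum: "at_site D k (\<Sum>x\<in>J. A x) i j = (\<Sum>x\<in>J. at_site D k (A x) i j)"
proof -
  have "hs_inner U ((\<Sum>x\<in>J. A x) ** V) = (\<Sum>x\<in>J. hs_inner U (A x ** V))" for U V
    by (simp only: hs_inner_def matrix_sum_mult_right matrix_sum_mult_left trace_sum)
  moreover have "(if c then \<Sum>x\<in>J. f x else 0) = (\<Sum>x\<in>J. if c then f x else 0)" for c and f :: "'a \<Rightarrow> complex"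
    by simp
  ultimately show ?thesis by (simp only: at_site_def)
qed

lemma trace_mult_diff: "trace (X ** (E - F)) = trace (X ** E) - trace (X ** F)"
  for X :: "'a :: comm_ring_1^'n^'n"
  by (simp add: trace_def matrix_matrix_mult_def algebra_simps sum_subtractf)

lemma tendsto_trace_mult:
  fixes X :: cmat2
  assumes "E \<longlonglongrightarrow> R" shows "(\<lambda>k. trace (X ** E k)) \<longlonglongrightarrow> trace (X ** R)"
  unfolding trace_def matrix_matrix_mult_def
  by (simp add: sum_2) (intro tendsto_intros assms)

lemma cmod_trace_mult_le:
  fixes X E :: cmat2
  shows "cmod (trace (X ** E)) \<le> (\<Sum>i\<in>UNIV. \<Sum>j\<in>UNIV. cmod (X $ i $ j)) * norm E"
proof -
  have "cmod (E $ i $ j) \<le> norm E" for i j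
    using Finite_Cartesian_Product.norm_nth_le[of "E $ i" j] Finite_Cartesian_Product.norm_nth_le[of E i] by linarith
  hence "cmod (X $ i $ j * E $ j $ i) \<le> cmod (X $ i $ j) * norm E" for i j
    by (simp add: norm_mult mult_left_mono)
  thus ?thesis
    unfolding trace_def matrix_matrix_mult_def sum_distrib_right
    by (auto intro!: order_trans[OF norm_sum] sum_mono)
qed

lemma density_matrix_funpow:
  assumes cp: "completely_positive \<Phi>" and tp: "trace_preserving \<Phi>"
    and \<rho>: "density_matrix \<rho>"
  shows "density_matrix ((\<Phi> ^^ k) \<rho>)"
proof (induction k)
  case (Suc k)
  \<comment> \<open>Positivity is complete positivity for blocks of size one.\<close>
  have psd: "psd A \<longleftrightarrow> block_psd 1 (\<lambda>_ _. A)" for A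
  proof
    assume "psd A"
    thus "block_psd 1 (\<lambda>_ _. A)" by (simp add: psd_def block_psd_def)
  next
    assume a: "block_psd 1 (\<lambda>_ _. A)"
    show "psd A" unfolding psd_def
    proof
      fix v :: "complex^2"
      show "(\<Sum>r\<in>UNIV. cnj (v $ r) * (A *v v) $ r) \<in> \<real>\<^sub>\<ge>\<^sub>0"
        using a[unfolded block_psd_def, rule_format, of "\<lambda>_. v"] by simp
    qed
  qed
  show ?case using Suc cp tp
    by (simp add: density_matrix_def psd trace_preserving_def completely_positive_def)
qed (simp add: \<rho>)

text \<open>Built by left multiplication from \<open>mat 1\<close>, the shape in which
  \<open>site_product\<close> accumulates a repeated letter.\<close>

definition matpow :: "cmat2 \<Rightarrow> nat \<Rightarrow> cmat2" where
  "matpow A j = ((**) A ^^ j) (mat 1)"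

text \<open>With a single operator per site the order of a word becomes irrelevant and only
  multiplicities count. This is what lets exponential generating functions enter.\<close>

lemma site_product_diagonal:
  "site_product (map (\<lambda>k. (k, A k)) ys) l = matpow (A l) (count_list ys l)"
  by (induction ys) (auto simp: site_product_def matpow_def)

lemma vacuum_moment_site_sum:
  assumes dens: "\<And>k. density_matrix (D k)"
  shows "foldr op_mult (replicate p (\<lambda>i j. \<Sum>k<N. at_site D k (A k) i j)) op_id 0 0 =
    fact p * fps_nth (\<Prod>k<N. egf (\<lambda>j. trace (matpow (A k) j ** D k))) p"
proof -
  have "foldr op_mult (replicate p (\<lambda>i j. \<Sum>k<N. at_site D k (A k) i j)) op_id 0 0 =
     (\<Sum>ys\<in>words {..<N} p. foldr op_mult (map (\<lambda>k. at_site D k (A k)) ys) op_id 0 0)"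
    by (subst foldr_op_mult_sum_power[of _ _ D]) (auto simp: local_algebra_at_site)
  also have "\<dots> = (\<Sum>ys\<in>words {..<N} p. \<Prod>l<N. trace (matpow (A l) (count_list ys l) ** D l))"
  proof (rule sum.cong[OF refl])
    fix ys assume "ys \<in> words {..<N} p"
    hence "fst ` set (map (\<lambda>k. (k, A k)) ys) \<subseteq> {..<N}" by (auto simp: image_image)
    from word_expectation[OF dens this]
    show "foldr op_mult (map (\<lambda>k. at_site D k (A k)) ys) op_id 0 0 =
        (\<Prod>l<N. trace (matpow (A l) (count_list ys l) ** D l))"
      by (simp add: o_def site_product_diagonal)
  qed
  also have "\<dots> = fact p * fps_nth (\<Prod>k<N. egf (\<lambda>j. trace (matpow (A k) j ** D k))) p"
    by (rule sum_words_prod_count) simp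
  finally show ?thesis .
qed

text \<open>The linear form is rewritten with one operator per site. The limiting variance runs over
  ordered pairs of letters and is complex as it stands; its antisymmetric part cancels
  later.\<close>

lemma quantum_clt:
  fixes A :: "'i \<Rightarrow> cmat2" and \<tau> :: "'i \<Rightarrow> real"
  assumes dens: "\<And>k. density_matrix (D k)" and lim: "D \<longlonglongrightarrow> R"
    and rate: "(\<lambda>k. norm (D k - R)) \<in> o(\<lambda>n. 1 / sqrt (real n))"
    and J: "finite J" and \<tau>: "\<And>x. x \<in> J \<Longrightarrow> 0 \<le> \<tau> x"
    and centered: "\<And>x. x \<in> J \<Longrightarrow> trace (A x ** R) = 0"
  shows "(\<lambda>n. foldr op_mult (replicate p (\<lambda>i j. \<Sum>x\<in>J. scaled_sum D (A x) n (\<tau> x) i j)) op_id 0 0)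
    \<longlonglongrightarrow> fact p * gauss_coeff (\<Sum>x\<in>J. \<Sum>y\<in>J. of_real (min (\<tau> x) (\<tau> y)) * trace (A x ** A y ** R)) p"
proof -
  define \<nu> where "\<nu> n t = nat \<lfloor>real n * t\<rfloor>" for n t
  \<comment> \<open>Only a common upper bound of the times is wanted; the sum also serves when
    \<open>J\<close> is empty.\<close>
  define t where "t = (\<Sum>x\<in>J. \<tau> x)"
  have t: "0 \<le> t" using \<tau> by (auto simp: t_def intro: sum_nonneg)
  have \<tau>t: "\<tau> x \<le> t" if "x \<in> J" for x using J \<tau> that by (auto simp: t_def intro: member_le_sum)
  \<comment> \<open>The total operator at site k: the letters whose time reaches beyond that
    site.\<close>
  define Bm where "Bm n k = (\<Sum>x\<in>{x\<in>J. k < \<nu> n (\<tau> x)}. A x)" for n k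
  define q where "q n k j = trace (matpow (Bm n k) j ** D k)" for n k j
  have \<nu>_mono: "\<nu> n a \<le> \<nu> n b" if "a \<le> b" for n a b
    unfolding \<nu>_def using that by (intro nat_mono floor_mono mult_left_mono) auto
  have swap: "(\<Sum>k<\<nu> n t. \<Sum>x\<in>{x\<in>J. k < \<nu> n (\<tau> x)}. f x k) = (\<Sum>x\<in>J. \<Sum>k<\<nu> n (\<tau> x). f x k)"
    for f :: "'i \<Rightarrow> nat \<Rightarrow> complex" and n
  proof -
    have "(\<Sum>k<\<nu> n t. \<Sum>x\<in>{x\<in>J. k < \<nu> n (\<tau> x)}. f x k) = (\<Sum>x\<in>J. \<Sum>k | k < \<nu> n t \<and> k < \<nu> n (\<tau> x). f x k)"
      using J sum.swap_restrict[of "{..<\<nu> n t}" J "\<lambda>k x. f x k" "\<lambda>k x. k < \<nu> n (\<tau> x)"] by simp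
    also have "\<dots> = (\<Sum>x\<in>J. \<Sum>k<\<nu> n (\<tau> x). f x k)"
      using \<nu>_mono[OF \<tau>t] by (intro sum.cong) (auto intro: less_le_trans)
    finally show ?thesis .
  qed
  have linear_form: "(\<Sum>x\<in>J. scaled_sum D (A x) n (\<tau> x) i j) =
      complex_of_real (1 / sqrt (real n)) * (\<Sum>k<\<nu> n t. at_site D k (Bm n k) i j)" for n i j
    unfolding Bm_def at_site_sum swap by (simp only: scaled_sum_def \<nu>_def sum_distrib_left)
  have eq: "foldr op_mult (replicate p (\<lambda>i j. \<Sum>x\<in>J. scaled_sum D (A x) n (\<tau> x) i j)) op_id 0 0
     = fact p * (fps_nth (\<Prod>k<\<nu> n t. egf (q n k)) p / of_real (sqrt (real n)) ^ p)" for n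
    unfolding linear_form foldr_op_mult_scale vacuum_moment_site_sum[OF dens]
    by (simp add: q_def[abs_def] power_divide)
  have q0: "q n k 0 = 1" for n k
    using dens[of k] by (simp add: q_def matpow_def density_matrix_def)
  have q1: "q n k 1 = (\<Sum>x\<in>{x\<in>J. k < \<nu> n (\<tau> x)}. trace (A x ** D k))" for n k
    by (simp add: q_def matpow_def Bm_def matrix_sum_mult_right trace_sum)
  have q2: "q n k 2 = (\<Sum>x\<in>{x\<in>J. k < \<nu> n (\<tau> x)}. \<Sum>y\<in>{y\<in>J. k < \<nu> n (\<tau> y)}. trace (A x ** A y ** D k))" for n k
  proof -
    have "matpow X 2 = X ** X" for X by (simp add: matpow_def numeral_2_eq_2)
    thus ?thesis
      by (simp only: q_def Bm_def matrix_sum_mult_right trace_sum) (simp only: matrix_sum_mult_left matrix_sum_mult_right trace_sum)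
  qed
  have first: "(\<lambda>n. (\<Sum>k<\<nu> n t. q n k 1) / of_real (sqrt (real n))) \<longlonglongrightarrow> 0"
  proof -
    have "(\<lambda>n. (\<Sum>k<\<nu> n (\<tau> x). trace (A x ** D k)) / of_real (sqrt (real n))) \<longlonglongrightarrow> 0" if x: "x \<in> J" for x
    proof (rule Lim_null_comparison)
      let ?K = "\<Sum>i\<in>UNIV. \<Sum>j\<in>UNIV. cmod (A x $ i $ j)"
      \<comment> \<open>Centering at \<open>R\<close> turns the mean at site k into a trace against
        \<open>D k - R\<close>.\<close>
      have "cmod (trace (A x ** D k)) \<le> ?K * norm (D k - R)" for k
        using cmod_trace_mult_le[of "A x" "D k - R"] centered[OF x]
        by (simp add: trace_mult_diff)
      hence "cmod (\<Sum>k<\<nu> n (\<tau> x). trace (A x ** D k)) \<le> ?K * (\<Sum>k<\<nu> n (\<tau> x). norm (D k - R))" for n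
        unfolding sum_distrib_left by (intro order_trans[OF norm_sum] sum_mono)
      thus "\<forall>\<^sub>F n in sequentially. cmod ((\<Sum>k<\<nu> n (\<tau> x). trace (A x ** D k)) / of_real (sqrt (real n)))
          \<le> ?K * ((\<Sum>k<\<nu> n (\<tau> x). norm (D k - R)) / sqrt (real n))"
        by (auto simp: norm_divide intro!: always_eventually divide_right_mono)
      show "(\<lambda>n. ?K * ((\<Sum>k<\<nu> n (\<tau> x). norm (D k - R)) / sqrt (real n))) \<longlonglongrightarrow> 0"
        unfolding \<nu>_def by (intro tendsto_mult_right_zero sum_smallo_inverse_sqrt rate \<tau> x) auto
    qed
    from tendsto_sum[OF this] show ?thesis by (simp only: q1 swap sum_divide_distrib) simp
  qed
  \<comment> \<open>The pair x, y meets exactly at the sites below both time limits; this is the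
    origin of the factor min, the covariance of Brownian motion in time.\<close>
  have second: "(\<lambda>n. (\<Sum>k<\<nu> n t. q n k 2) / of_nat n) \<longlonglongrightarrow>
     (\<Sum>x\<in>J. \<Sum>y\<in>J. of_real (min (\<tau> x) (\<tau> y)) * trace (A x ** A y ** R))"
  proof -
    have "(\<Sum>k<\<nu> n t. q n k 2) = (\<Sum>x\<in>J. \<Sum>y\<in>J. \<Sum>k<\<nu> n (min (\<tau> x) (\<tau> y)). trace (A x ** A y ** D k))" for n
    proof -
      have "(\<Sum>k<\<nu> n (\<tau> x). \<Sum>y\<in>{y\<in>J. k < \<nu> n (\<tau> y)}. f y k) = (\<Sum>y\<in>J. \<Sum>k<\<nu> n (min (\<tau> x) (\<tau> y)). f y k)"
        for f :: "'i \<Rightarrow> nat \<Rightarrow> complex" and x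
      proof -
        have "(\<Sum>k<\<nu> n (\<tau> x). \<Sum>y\<in>{y\<in>J. k < \<nu> n (\<tau> y)}. f y k) = (\<Sum>y\<in>J. \<Sum>k | k < \<nu> n (\<tau> x) \<and> k < \<nu> n (\<tau> y). f y k)"
          using J sum.swap_restrict[of "{..<\<nu> n (\<tau> x)}" J "\<lambda>k x. f x k" "\<lambda>k x. k < \<nu> n (\<tau> x)"] by simp
        moreover have "\<nu> n (min a b) = min (\<nu> n a) (\<nu> n b)" for a b
          using \<nu>_mono[of a b] \<nu>_mono[of b a] by (cases "a \<le> b") auto
        ultimately show ?thesis by (simp add: lessThan_def)
      qed
      thus ?thesis by (simp only: q2 swap)
    qed
    moreover have "(\<lambda>n. (\<Sum>k<\<nu> n (min (\<tau> x) (\<tau> y)). trace (A x ** A y ** D k)) / of_nat n)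
        \<longlonglongrightarrow> of_real (min (\<tau> x) (\<tau> y)) * trace (A x ** A y ** R)" if "x \<in> J" "y \<in> J" for x y
      unfolding \<nu>_def using \<tau> that by (intro cesaro tendsto_trace_mult lim) auto
    ultimately show ?thesis by (simp only: sum_divide_distrib) (intro tendsto_sum)
  qed
  \<comment> \<open>The single-site means tend to 0, hence so do the averages of their
    squares.\<close>
  have third: "(\<lambda>n. (\<Sum>k<\<nu> n t. (q n k 1)\<^sup>2) / of_nat n) \<longlonglongrightarrow> 0"
  proof (rule Lim_null_comparison)
    define b where "b k = (\<Sum>x\<in>J. cmod (trace (A x ** D k)))" for k
    have "(\<lambda>k. trace (A x ** D k)) \<longlonglongrightarrow> 0" if "x \<in> J" for x
      using tendsto_trace_mult[OF lim, of "A x"] centered[OF that] by simp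
    hence "b \<longlonglongrightarrow> 0" unfolding b_def by (intro tendsto_null_sum tendsto_norm_zero)
    hence "(\<lambda>k. (b k)\<^sup>2) \<longlonglongrightarrow> 0" using tendsto_power[of b 0 sequentially 2] by simp
    thus "(\<lambda>n. (\<Sum>k<\<nu> n t. (b k)\<^sup>2) / real n) \<longlonglongrightarrow> 0"
      unfolding \<nu>_def by (intro cesaro_null t) auto
    have "cmod (q n k 1) \<le> b k" for n k
      unfolding q1 b_def using J by (intro order_trans[OF norm_sum] sum_mono2) auto
    hence "cmod ((q n k 1)\<^sup>2) \<le> (b k)\<^sup>2" for n k
      by (simp add: norm_power power_mono)
    thus "\<forall>\<^sub>F n in sequentially. cmod ((\<Sum>k<\<nu> n t. (q n k 1)\<^sup>2) / of_nat n) \<le> (\<Sum>k<\<nu> n t. (b k)\<^sup>2) / real n"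
      by (auto simp: norm_divide intro!: always_eventually divide_right_mono order_trans[OF norm_sum] sum_mono)
  qed
  \<comment> \<open>\<open>Bm n k\<close> takes at most one value for each subset of
    \<open>J\<close>, and along the convergent \<open>D\<close> each of them has bounded moments;
    the maximum over \<open>Pow J\<close> is uniform in n and k.\<close>
  have bound: "\<exists>K. \<forall>n k. cmod (q n k j) \<le> K" for j
  proof -
    have "\<exists>K. \<forall>k. cmod (trace (matpow (\<Sum>x\<in>U. A x) j ** D k)) \<le> K" for U
      using convergent_imp_Bseq[OF convergentI[OF tendsto_trace_mult[OF lim, of "matpow (\<Sum>x\<in>U. A x) j"]]]
      by (auto simp: Bseq_def)
    then obtain K where K: "\<And>U k. cmod (trace (matpow (\<Sum>x\<in>U. A x) j ** D k)) \<le> K U" by metis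
    have "cmod (q n k j) \<le> Max (K ` Pow J)" for n k
      unfolding q_def Bm_def using J by (intro order_trans[OF K] Max_ge) auto
    thus ?thesis by blast
  qed
  have "(\<lambda>n. fps_nth (\<Prod>k<\<nu> n t. egf (q n k)) p / of_real (sqrt (real n)) ^ p)
    \<longlonglongrightarrow> gauss_coeff (\<Sum>x\<in>J. \<Sum>y\<in>J. of_real (min (\<tau> x) (\<tau> y)) * trace (A x ** A y ** R)) p"
  proof (rule fps_prod_clt)
    show "\<exists>K. \<forall>n k. cmod (fps_nth (egf (q n k)) j) \<le> K" for j
    proof -
      obtain K where "\<And>n k. cmod (q n k j) \<le> K" using bound by blast
      hence "cmod (fps_nth (egf (q n k)) j) \<le> K / fact j" for n k
        by (simp add: norm_divide divide_right_mono)
      thus ?thesis by blast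
    qed
    show "real (\<nu> n t) \<le> t * real n" for n unfolding \<nu>_def by (rule nat_floor_mult_le[OF t])
    show "(\<lambda>n. (\<Sum>k<\<nu> n t. fps_nth (egf (q n k)) 1) / of_real (sqrt (real n))) \<longlonglongrightarrow> 0"
      using first by simp
    show "(\<lambda>n. (\<Sum>k<\<nu> n t. 2 * fps_nth (egf (q n k)) 2 - (fps_nth (egf (q n k)) 1)\<^sup>2) / of_nat n)
      \<longlonglongrightarrow> (\<Sum>x\<in>J. \<Sum>y\<in>J. of_real (min (\<tau> x) (\<tau> y)) * trace (A x ** A y ** R))"
      using tendsto_diff[OF second third] by (simp add: sum_subtractf diff_divide_distrib)
  qed (simp add: q0)
  thus ?thesis unfolding eq by (rule tendsto_mult_left)
qed

section \<open>Symmetrized polynomials\<close>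

text \<open>The shape of each matrix entry of \<open>nc_eval\<close>. Rearrangements of a word with
  repeated letters coincide, so the keys of a symmetrized monomial do not correspond to
  permutations; additivity in \<open>Q\<close> restores the sum over permutations.\<close>

definition linear_extension :: "(nat list \<Rightarrow> complex) \<Rightarrow> nc_poly \<Rightarrow> complex" where
  "linear_extension f Q = (\<Sum>w\<in>Poly_Mapping.keys Q. Poly_Mapping.lookup Q w * f w)"

lemma linear_extension_superset:
  "finite S \<Longrightarrow> Poly_Mapping.keys Q \<subseteq> S \<Longrightarrow> linear_extension f Q = (\<Sum>w\<in>S. Poly_Mapping.lookup Q w * f w)"
  unfolding linear_extension_def by (rule sum.mono_neutral_left) (auto simp: in_keys_iff)

lemma linear_extension_add: "linear_extension f (Q + Q') = linear_extension f Q + linear_extension f Q'"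
proof -
  let ?S = "Poly_Mapping.keys Q \<union> Poly_Mapping.keys Q'"
  have "linear_extension f R = (\<Sum>w\<in>?S. Poly_Mapping.lookup R w * f w)" if "R \<in> {Q, Q', Q + Q'}" for R
    using that keys_add[of Q Q'] by (intro linear_extension_superset) auto
  thus ?thesis by (simp add: lookup_add distrib_right sum.distrib)
qed

lemma linear_extension_sum: "linear_extension f (\<Sum>x\<in>J. Q x) = (\<Sum>x\<in>J. linear_extension f (Q x))"
proof (induction J rule: infinite_finite_induct)
  case (insert x F)
  thus ?case by (simp add: linear_extension_add)
qed (simp_all add: linear_extension_def)

lemma linear_extension_single: "linear_extension f (Poly_Mapping.single w c) = c * f w"
  by (simp add: linear_extension_def)

lemma nc_eval_symmetrized:
  assumes as: "\<And>\<mu> x. \<mu> \<in> Poly_Mapping.keys P \<Longrightarrow> x \<in> set (monomial_word \<mu>) \<Longrightarrow> as ! x \<in> local_algebra D"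
  shows "nc_eval as (symmetrized P) i j = (\<Sum>\<mu>\<in>Poly_Mapping.keys P. let w = monomial_word \<mu>; p = length w in
     Poly_Mapping.lookup P \<mu> * (\<Sum>T\<in>Pow {..<p}. (- 1) ^ (p - card T) *
       foldr op_mult (replicate p (\<lambda>i j. \<Sum>l\<in>T. (as ! (w ! l)) i j)) op_id i j) / fact p)"
proof -
  let ?f = "\<lambda>w. foldr op_mult (map ((!) as) w) op_id i j"
  have "nc_eval as (symmetrized P) i j = linear_extension ?f (symmetrized P)"
    by (simp add: nc_eval_def linear_extension_def)
  also have "\<dots> = (\<Sum>\<mu>\<in>Poly_Mapping.keys P. let w = monomial_word \<mu>; p = length w in
     Poly_Mapping.lookup P \<mu> * (\<Sum>T\<in>Pow {..<p}. (- 1) ^ (p - card T) *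
       foldr op_mult (replicate p (\<lambda>i j. \<Sum>l\<in>T. (as ! (w ! l)) i j)) op_id i j) / fact p)"
    unfolding symmetrized_def linear_extension_sum
  proof (rule sum.cong[OF refl])
    fix \<mu> assume \<mu>: "\<mu> \<in> Poly_Mapping.keys P"
    define w where "w = monomial_word \<mu>"
    define p where "p = length w"
    \<comment> \<open>Polarization is applied to the positions in the word rather than to the
      variables, so repeated variables count as distinct letters.\<close>
    define X where "X l = as ! (w ! l)" for l
    have X: "X l \<in> local_algebra D" if "l < p" for l
      using that as[OF \<mu>] by (simp add: X_def w_def p_def)
    have "linear_extension ?f (symmetrized_monomial \<mu> (Poly_Mapping.lookup P \<mu>)) =
       Poly_Mapping.lookup P \<mu> / fact p * (\<Sum>\<pi> | \<pi> permutes {..<p}. foldr op_mult (map X (map \<pi> [0..<p])) op_id i j)"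
      unfolding symmetrized_monomial_def Let_def w_def[symmetric] p_def[symmetric] linear_extension_sum linear_extension_single
      by (simp add: sum_distrib_left permute_list_def X_def[abs_def] p_def[symmetric] o_def)
    also have "(\<Sum>\<pi> | \<pi> permutes {..<p}. foldr op_mult (map X (map \<pi> [0..<p])) op_id i j) =
       (\<Sum>T\<in>Pow {..<p}. (- 1) ^ (p - card T) * (\<Sum>xs\<in>words T p. foldr op_mult (map X xs) op_id i j))"
      by (rule polarization)
    also have "\<dots> = (\<Sum>T\<in>Pow {..<p}. (- 1) ^ (p - card T) *
       foldr op_mult (replicate p (\<lambda>i j. \<Sum>l\<in>T. X l i j)) op_id i j)"
    proof (intro sum.cong refl arg_cong2[where f = "(*)"])
      fix T assume T: "T \<in> Pow {..<p}"
      have "finite T" "\<And>l. l \<in> T \<Longrightarrow> X l \<in> local_algebra D" using T X by (auto intro: finite_subset)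
      thus "(\<Sum>xs\<in>words T p. foldr op_mult (map X xs) op_id i j) =
          foldr op_mult (replicate p (\<lambda>i j. \<Sum>l\<in>T. X l i j)) op_id i j"
        by (simp only: foldr_op_mult_sum_power[of T X D])
    qed
    finally show "linear_extension ?f (symmetrized_monomial \<mu> (Poly_Mapping.lookup P \<mu>)) =
      (let w = monomial_word \<mu>; p = length w in
       Poly_Mapping.lookup P \<mu> * (\<Sum>T\<in>Pow {..<p}. (- 1) ^ (p - card T) *
       foldr op_mult (replicate p (\<lambda>i j. \<Sum>l\<in>T. (as ! (w ! l)) i j)) op_id i j) / fact p)"
      unfolding Let_def w_def[symmetric] p_def[symmetric] X_def by simp
  qed
  finally show ?thesis .
qed

section \<open>Words of monomials and evaluation in commuting variables\<close>

lemma set_monomial_word: "set (monomial_word \<mu>) \<subseteq> Poly_Mapping.keys \<mu>"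
  by (auto simp: monomial_word_def)

lemma keys_symmetrized:
  assumes "u \<in> Poly_Mapping.keys (symmetrized P)"
  shows "\<exists>\<mu>\<in>Poly_Mapping.keys P. set u \<subseteq> set (monomial_word \<mu>)"
proof -
  have sub: "Poly_Mapping.keys (\<Sum>x\<in>J. f x) \<subseteq> (\<Union>x\<in>J. Poly_Mapping.keys (f x))" for J and f :: "'i \<Rightarrow> nc_poly"
    by (rule keys_sum)
  obtain \<mu> where \<mu>: "\<mu> \<in> Poly_Mapping.keys P"
    "u \<in> Poly_Mapping.keys (symmetrized_monomial \<mu> (Poly_Mapping.lookup P \<mu>))"
    using assms sub unfolding symmetrized_def by blast
  then obtain \<pi> where "\<pi> permutes {..<length (monomial_word \<mu>)}" "u = permute_list \<pi> (monomial_word \<mu>)"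
    using sub unfolding symmetrized_monomial_def Let_def by (fastforce split: if_splits)
  thus ?thesis using \<mu>(1) by auto
qed

lemma prod_list_monomial_word:
  fixes f :: "nat \<Rightarrow> 'a :: comm_monoid_mult"
  shows "prod_list (map f (monomial_word \<mu>)) = (\<Prod>x\<in>Poly_Mapping.keys \<mu>. f x ^ Poly_Mapping.lookup \<mu> x)"
proof -
  have "prod_list (map f (concat (map (\<lambda>x. replicate (Poly_Mapping.lookup \<mu> x) x) xs))) =
      prod_list (map (\<lambda>x. f x ^ Poly_Mapping.lookup \<mu> x) xs)" for xs
    by (induction xs) (simp_all add: prod_list_replicate)
  thus ?thesis by (simp add: monomial_word_def prod.distinct_set_conv_list[symmetric])
qed

lemma poly_eval_polarized:
  "poly_eval xs P = (\<Sum>\<mu>\<in>Poly_Mapping.keys P. let w = monomial_word \<mu>; p = length w in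
     Poly_Mapping.lookup P \<mu> * (\<Sum>T\<in>Pow {..<p}. (- 1) ^ (p - card T) * (\<Sum>l\<in>T. xs ! (w ! l)) ^ p) / fact p)"
  unfolding poly_eval_def Let_def prod_list_monomial_word[symmetric]
  by (subst prod_list_polarization) simp

lemma concat_triples_nth:
  assumes "x < 3 * length ts"
  shows "concat (map (\<lambda>t. [f t, g t, h t]) ts) ! x = ([f, g, h] ! (x mod 3)) (ts ! (x div 3))"
  using assms
proof (induction ts arbitrary: x)
  case (Cons t ts)
  show ?case
  proof (cases "x < 3")
    case True
    hence "x = 0 \<or> x = 1 \<or> x = 2" by auto
    thus ?thesis by auto
  next
    case False
    then obtain y where y: "x = y + 3" by (metis add.commute le_Suc_ex not_less)
    hence "x = Suc (Suc (Suc y))" by simp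
    thus ?thesis using Cons y by simp
  qed
qed simp

text \<open>A sum over all ordered pairs only sees the symmetric part of its summand. Applied to the
  traces of products, this removes the commutators and leaves the real covariance.\<close>

lemma sum_sum_symmetrize:
  fixes f g :: "'i \<Rightarrow> 'i \<Rightarrow> 'a :: field_char_0"
  assumes "\<And>x y. x \<in> J \<Longrightarrow> y \<in> J \<Longrightarrow> f x y + f y x = 2 * g x y"
  shows "(\<Sum>x\<in>J. \<Sum>y\<in>J. f x y) = (\<Sum>x\<in>J. \<Sum>y\<in>J. g x y)"
proof -
  have "2 * (\<Sum>x\<in>J. \<Sum>y\<in>J. f x y) = (\<Sum>x\<in>J. \<Sum>y\<in>J. f x y) + (\<Sum>x\<in>J. \<Sum>y\<in>J. f y x)"
    by (subst (3) sum.swap) simp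
  also have "\<dots> = (\<Sum>x\<in>J. \<Sum>y\<in>J. f x y + f y x)" by (simp add: sum.distrib)
  also have "\<dots> = 2 * (\<Sum>x\<in>J. \<Sum>y\<in>J. g x y)" using assms by (simp add: sum_distrib_left)
  finally show ?thesis by simp
qed

text \<open>The expectations of the Pauli matrices under \<open>R\<close> are v1, v2, v3, and their
  anticommutators are 2 \<delta>_ab. Expanding the anticommutator of the centered matrices leaves 2
  (\<delta>_ab - v_a v_b), which is twice the entry of \<open>C\<close>.\<close>

lemma
  fixes \<beta> :: complex and \<alpha> v1 v2 v3 :: real and R :: cmat2 and C :: "real^3^3"
  defines "S \<equiv> [sigma_x - mat (of_real v1), sigma_y - mat (of_real v2), sigma_z - mat (of_real v3)]"
  assumes R: "R = vector [vector [of_real \<alpha>, \<beta>], vector [cnj \<beta>, 1 - of_real \<alpha>]]"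
    and v: "v1 = 2 * Re \<beta>" "v2 = - 2 * Im \<beta>" "v3 = 2 * \<alpha> - 1"
    and C: "C = vector
          [vector [1 - v1\<^sup>2, - v1 * v2, - v1 * v3],
           vector [- v1 * v2, 1 - v2\<^sup>2, - v2 * v3],
           vector [- v1 * v3, - v2 * v3, 1 - v3\<^sup>2]]"
  shows trace_centered_pauli: "a < 3 \<Longrightarrow> trace (S ! a ** R) = 0"
    and anticommutator_centered_pauli: "a < 3 \<Longrightarrow> b < 3 \<Longrightarrow>
      trace (S ! a ** S ! b ** R) + trace (S ! b ** S ! a ** R) =
        2 * complex_of_real (C $ ([1, 2, 3] ! a) $ ([1, 2, 3] ! b))"
proof -
  have lt3: "a < 3 \<longleftrightarrow> a = 0 \<or> a = 1 \<or> a = 2" for a :: nat by auto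
  have S: "S ! 0 = sigma_x - mat (of_real v1)" "S ! 1 = sigma_y - mat (of_real v2)" "S ! 2 = sigma_z - mat (of_real v3)"
    by (simp_all add: S_def)
  note entries = trace_def matrix_matrix_mult_def sum_2 mat_def sigma_x_def sigma_y_def sigma_z_def R
  show "trace (S ! a ** R) = 0" if "a < 3"
    using that unfolding lt3
    by (elim disjE; simp only: S) (simp_all add: entries complex_eq_iff v algebra_simps)
  have idx: "[1, 2, 3] ! 0 = (1 :: 3)" "[1, 2, 3] ! 1 = (2 :: 3)" "[1, 2, 3] ! 2 = (3 :: 3)" by simp_all
  show "trace (S ! a ** S ! b ** R) + trace (S ! b ** S ! a ** R) =
        2 * complex_of_real (C $ ([1, 2, 3] ! a) $ ([1, 2, 3] ! b))" if "a < 3" "b < 3"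
    using that unfolding lt3
    by (elim disjE; simp only: S idx)
      (simp_all add: entries C complex_eq_iff v algebra_simps power2_eq_square)
qed

theorem theorem3p1:
  fixes \<Phi> :: "complex^2^2 \<Rightarrow> complex^2^2"
    and \<rho> \<rho>_inf :: "complex^2^2"
    and \<alpha> :: real and \<beta> :: complex and v1 v2 v3 :: real
    and D :: "nat \<Rightarrow> complex^2^2"
    and M :: "'w measure" and B :: "real \<Rightarrow> 'w \<Rightarrow> real^3" and C :: "real^3^3"
    and m :: nat and P :: cpoly and ts :: "real list"
  assumes linear: "complex_linear_map \<Phi>"
    and cp: "completely_positive \<Phi>"
    and tp: "trace_preserving \<Phi>"
    and ergodic: "\<forall>\<tau>. density_matrix \<tau> \<longrightarrow>
          (\<exists>\<tau>_inf. stationary \<Phi> \<tau>_inf \<and> (\<lambda>n. (\<Phi> ^^ n) \<tau>) \<longlonglongrightarrow> \<tau>_inf)"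
    and state: "density_matrix \<rho>"
    and limit: "(\<lambda>n. (\<Phi> ^^ n) \<rho>) \<longlonglongrightarrow> \<rho>_inf"
    and entries: "\<rho>_inf = vector [vector [of_real \<alpha>, \<beta>], vector [cnj \<beta>, 1 - of_real \<alpha>]]"
    and v1: "v1 = 2 * Re \<beta>"
    and v2: "v2 = - 2 * Im \<beta>"
    and v3: "v3 = 2 * \<alpha> - 1"
    and factors: "D = (\<lambda>k. (\<Phi> ^^ k) \<rho>)"
    and rate: "(\<lambda>n. norm ((\<Phi> ^^ n) \<rho> - \<rho>_inf)) \<in> o(\<lambda>n. 1 / sqrt (real n))"
    and cov: "C = vector
          [vector [1 - v1\<^sup>2, - v1 * v2, - v1 * v3],
           vector [- v1 * v2, 1 - v2\<^sup>2, - v2 * v3],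
           vector [- v1 * v3, - v2 * v3, 1 - v3\<^sup>2]]"
    and bm: "centered_brownian_motion_3d M C B"
    and m: "1 \<le> m"
    and P: "poly_in_vars (3 * m) P"
    and times: "length ts = m" "\<forall>t\<in>set ts. 0 \<le> t" "sorted_wrt (<) ts"
  shows "(\<lambda>n. product_state D
            (nc_eval
              (concat (map (\<lambda>t. [scaled_sum D (sigma_x - mat (of_real v1)) n t,
                                 scaled_sum D (sigma_y - mat (of_real v2)) n t,
                                 scaled_sum D (sigma_z - mat (of_real v3)) n t]) ts))
              (symmetrized P)))
         \<longlonglongrightarrow>
         (\<integral>w. poly_eval
              (concat (map (\<lambda>t. [complex_of_real (B t w $ 1),
                                 complex_of_real (B t w $ 2),
                                 complex_of_real (B t w $ 3)]) ts)) P \<partial>M)"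
proof -
  interpret bm: centered_brownian_motion_3d M C B by (rule bm)
  have dens: "density_matrix (D k)" for k
    unfolding factors by (rule density_matrix_funpow[OF cp tp state])
  have lim: "D \<longlonglongrightarrow> \<rho>_inf" using limit by (simp add: factors)
  have rate': "(\<lambda>k. norm (D k - \<rho>_inf)) \<in> o(\<lambda>n. 1 / sqrt (real n))" using rate by (simp add: factors)
  define S where "S = [sigma_x - mat (of_real v1), sigma_y - mat (of_real v2), sigma_z - mat (of_real v3)]"
  \<comment> \<open>Variable \<open>x\<close> belongs to the time number \<open>x div 3\<close> and
    to the coordinate \<open>x mod 3\<close>, in the order of the concatenated triples.\<close>
  define A where "A x = S ! (x mod 3)" for x
  define \<tau> where "\<tau> x = ts ! (x div 3)" for x
  define a where "a x = ([1, 2, 3] :: 3 list) ! (x mod 3)" for x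
  define ops where "ops n = concat (map (\<lambda>t. [scaled_sum D (sigma_x - mat (of_real v1)) n t,
      scaled_sum D (sigma_y - mat (of_real v2)) n t, scaled_sum D (sigma_z - mat (of_real v3)) n t]) ts)" for n
  define Bs where "Bs w = concat (map (\<lambda>t. [complex_of_real (B t w $ 1),
      complex_of_real (B t w $ 2), complex_of_real (B t w $ 3)]) ts)" for w
  have mod3: "x mod 3 = 0 \<or> x mod 3 = 1 \<or> x mod 3 = 2" for x :: nat by auto
  have ops: "ops n ! x = scaled_sum D (A x) n (\<tau> x)" if "x < 3 * m" for n x
    using that times(1) mod3[of x] unfolding ops_def A_def \<tau>_def S_def
    by (subst concat_triples_nth) auto
  have Bs: "Bs w ! x = complex_of_real (B (\<tau> x) w $ a x)" if "x < 3 * m" for w x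
    using that times(1) mod3[of x] unfolding Bs_def a_def \<tau>_def
    by (subst concat_triples_nth) auto
  have \<tau>: "0 \<le> \<tau> x" if "x < 3 * m" for x
    using that times by (auto simp: \<tau>_def)
  have letters: "x < 3 * m" if "\<mu> \<in> Poly_Mapping.keys P" "x \<in> set (monomial_word \<mu>)" for \<mu> x
    using that P set_monomial_word unfolding poly_in_vars_def by blast
  have letter_nth: "monomial_word \<mu> ! l < 3 * m"
    if "\<mu> \<in> Poly_Mapping.keys P" "T \<subseteq> {..<length (monomial_word \<mu>)}" "l \<in> T" for \<mu> T l
    using that by (intro letters[OF that(1)] nth_mem) auto
  have moment: "(\<lambda>n. foldr op_mult (replicate p (\<lambda>i j. \<Sum>l\<in>T. (ops n ! x l) i j)) op_id 0 0)
      \<longlonglongrightarrow> (\<integral>w. (\<Sum>l\<in>T. Bs w ! x l) ^ p \<partial>M)"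
    and integrable: "integrable M (\<lambda>w. (\<Sum>l\<in>T. Bs w ! x l) ^ p)"
    if T: "finite T" and x: "\<And>l. l \<in> T \<Longrightarrow> x l < 3 * m" for T p and x :: "nat \<Rightarrow> nat"
  proof -
    let ?G = "\<lambda>w. \<Sum>l\<in>T. B (\<tau> (x l)) w $ a (x l)"
    let ?V = "\<Sum>k\<in>T. \<Sum>l\<in>T. C $ a (x k) $ a (x l) * min (\<tau> (x k)) (\<tau> (x l))"
    have Bsum: "(\<Sum>l\<in>T. Bs w ! x l) ^ p = complex_of_real (?G w ^ p)" for w
      using Bs x by simp
    have "integrable M (\<lambda>w. ?G w ^ p)"
      using T \<tau> x by (intro bm.integrable_sum_power) auto
    thus "integrable M (\<lambda>w. (\<Sum>l\<in>T. Bs w ! x l) ^ p)" unfolding Bsum by (rule integrable_of_real)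
    have "(\<integral>w. (\<Sum>l\<in>T. Bs w ! x l) ^ p \<partial>M) = complex_of_real (\<integral>w. ?G w ^ p \<partial>M)"
      unfolding Bsum by (rule integral_complex_of_real)
    also have "(\<integral>w. ?G w ^ p \<partial>M) = fact p * gauss_coeff ?V p"
      using T \<tau> x by (intro bm.moments_of_sum) auto
    finally have rhs: "(\<integral>w. (\<Sum>l\<in>T. Bs w ! x l) ^ p \<partial>M) = fact p * gauss_coeff (complex_of_real ?V) p"
      by (simp only: gauss_coeff_of_real of_real_mult of_real_fact)
    \<comment> \<open>The weight min is symmetric in the two letters, so the anticommutators alone
      determine this sum.\<close>
    have V: "(\<Sum>k\<in>T. \<Sum>l\<in>T. of_real (min (\<tau> (x k)) (\<tau> (x l))) * trace (A (x k) ** A (x l) ** \<rho>_inf)) = complex_of_real ?V"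
      unfolding of_real_sum
    proof (rule sum_sum_symmetrize)
      fix k l
      have "trace (A (x k) ** A (x l) ** \<rho>_inf) + trace (A (x l) ** A (x k) ** \<rho>_inf)
          = 2 * complex_of_real (C $ a (x k) $ a (x l))"
        unfolding A_def a_def S_def
        by (rule anticommutator_centered_pauli[OF entries v1 v2 v3 cov]) auto
      thus "of_real (min (\<tau> (x k)) (\<tau> (x l))) * trace (A (x k) ** A (x l) ** \<rho>_inf) +
          of_real (min (\<tau> (x l)) (\<tau> (x k))) * trace (A (x l) ** A (x k) ** \<rho>_inf) =
          2 * complex_of_real (C $ a (x k) $ a (x l) * min (\<tau> (x k)) (\<tau> (x l)))"
        unfolding min.commute[of "\<tau> (x l)"] distrib_left[symmetric] by simp
    qed
    have lhs: "(\<lambda>i j. \<Sum>l\<in>T. (ops n ! x l) i j) = (\<lambda>i j. \<Sum>l\<in>T. scaled_sum D (A (x l)) n (\<tau> (x l)) i j)" for n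
      using ops x by simp
    show "(\<lambda>n. foldr op_mult (replicate p (\<lambda>i j. \<Sum>l\<in>T. (ops n ! x l) i j)) op_id 0 0)
      \<longlonglongrightarrow> (\<integral>w. (\<Sum>l\<in>T. Bs w ! x l) ^ p \<partial>M)"
      unfolding lhs rhs V[symmetric]
    proof (rule quantum_clt[OF dens lim rate' T])
      fix l assume "l \<in> T"
      thus "0 \<le> \<tau> (x l)" using \<tau> x by blast
      show "trace (A (x l) ** \<rho>_inf) = 0"
        unfolding A_def S_def by (rule trace_centered_pauli[OF entries v1 v2 v3 cov]) auto
    qed
  qed
  \<comment> \<open>The same finite combination of p-th moments serves the operators and the
    Gaussian variables; only the functional \<open>F\<close> is exchanged, so the limit can be taken
    term by term.\<close>
  let ?coeff = "\<lambda>\<mu> (F :: nat \<Rightarrow> (nat \<Rightarrow> nat) \<Rightarrow> nat set \<Rightarrow> complex). let w = monomial_word \<mu>; p = length w in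
     Poly_Mapping.lookup P \<mu> * (\<Sum>T\<in>Pow {..<p}. (- 1) ^ (p - card T) * F p (\<lambda>l. w ! l) T) / fact p"
  have alg: "ops n ! x \<in> local_algebra D" if "x < 3 * m" for n x
    by (simp add: ops[OF that] local_algebra_scaled_sum)
  have state_eq: "product_state D (nc_eval (ops n) (symmetrized P)) =
      (\<Sum>\<mu>\<in>Poly_Mapping.keys P. ?coeff \<mu> (\<lambda>p x T. foldr op_mult (replicate p (\<lambda>i j. \<Sum>l\<in>T. (ops n ! x l) i j)) op_id 0 0))" for n
  proof -
    have expand: "nc_eval (ops n) (symmetrized P) = (\<lambda>i j. \<Sum>\<mu>\<in>Poly_Mapping.keys P.
       ?coeff \<mu> (\<lambda>p x T. foldr op_mult (replicate p (\<lambda>i j. \<Sum>l\<in>T. (ops n ! x l) i j)) op_id i j))"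
      by (intro ext nc_eval_symmetrized[where D = D] alg letters)
    \<comment> \<open>Membership has to be known before the state can be read off as the vacuum
      entry.\<close>
    have "nc_eval (ops n) (symmetrized P) \<in> local_algebra D"
      unfolding nc_eval_def
    proof (intro local_algebra_sum local_algebra_scale local_algebra_foldr)
      fix u b assume "u \<in> Poly_Mapping.keys (symmetrized P)" "b \<in> set (map ((!) (ops n)) u)"
      thus "b \<in> local_algebra D" using alg letters keys_symmetrized[of u P] by fastforce
    qed
    thus ?thesis by (simp only: product_state_local expand)
  qed
  have "(\<lambda>n. product_state D (nc_eval (ops n) (symmetrized P))) \<longlonglongrightarrow>
      (\<Sum>\<mu>\<in>Poly_Mapping.keys P. ?coeff \<mu> (\<lambda>p x T. \<integral>w. (\<Sum>l\<in>T. Bs w ! x l) ^ p \<partial>M))"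
    unfolding state_eq Let_def
    by (intro tendsto_sum tendsto_divide tendsto_mult tendsto_const moment)
      (auto intro: finite_subset letter_nth)
  also have "(\<Sum>\<mu>\<in>Poly_Mapping.keys P. ?coeff \<mu> (\<lambda>p x T. \<integral>w. (\<Sum>l\<in>T. Bs w ! x l) ^ p \<partial>M)) = (\<integral>w. poly_eval (Bs w) P \<partial>M)"
  proof -
    have int: "integrable M (\<lambda>w. (\<Sum>l\<in>T. Bs w ! (monomial_word \<mu> ! l)) ^ p)"
      if "\<mu> \<in> Poly_Mapping.keys P" "T \<in> Pow {..<length (monomial_word \<mu>)}" for \<mu> T p
      using that by (intro integrable) (auto intro: finite_subset letter_nth)
    show ?thesis
      unfolding poly_eval_polarized Let_def
    proof (subst Bochner_Integration.integral_sum)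
      fix \<mu> assume \<mu>: "\<mu> \<in> Poly_Mapping.keys P"
      show "integrable M (\<lambda>w. Poly_Mapping.lookup P \<mu> * (\<Sum>T\<in>Pow {..<length (monomial_word \<mu>)}.
          (- 1) ^ (length (monomial_word \<mu>) - card T) *
          (\<Sum>l\<in>T. Bs w ! (monomial_word \<mu> ! l)) ^ length (monomial_word \<mu>)) / fact (length (monomial_word \<mu>)))"
        by (intro integrable_divide integrable_mult_right Bochner_Integration.integrable_sum int \<mu>)
    next
      show "(\<Sum>\<mu>\<in>Poly_Mapping.keys P. Poly_Mapping.lookup P \<mu> *
          (\<Sum>T\<in>Pow {..<length (monomial_word \<mu>)}. (- 1) ^ (length (monomial_word \<mu>) - card T) *
            (\<integral>w. (\<Sum>l\<in>T. Bs w ! (monomial_word \<mu> ! l)) ^ length (monomial_word \<mu>) \<partial>M)) / fact (length (monomial_word \<mu>)))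
        = (\<Sum>\<mu>\<in>Poly_Mapping.keys P. \<integral>w. Poly_Mapping.lookup P \<mu> * (\<Sum>T\<in>Pow {..<length (monomial_word \<mu>)}.
          (- 1) ^ (length (monomial_word \<mu>) - card T) *
          (\<Sum>l\<in>T. Bs w ! (monomial_word \<mu> ! l)) ^ length (monomial_word \<mu>)) / fact (length (monomial_word \<mu>)) \<partial>M)"
      proof (rule sum.cong[OF refl])
        fix \<mu> assume \<mu>: "\<mu> \<in> Poly_Mapping.keys P"
        have "(\<integral>w. (\<Sum>T\<in>Pow {..<length (monomial_word \<mu>)}. (- 1) ^ (length (monomial_word \<mu>) - card T) *
            (\<Sum>l\<in>T. Bs w ! (monomial_word \<mu> ! l)) ^ length (monomial_word \<mu>)) \<partial>M)
          = (\<Sum>T\<in>Pow {..<length (monomial_word \<mu>)}. \<integral>w. (- 1) ^ (length (monomial_word \<mu>) - card T) *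
            (\<Sum>l\<in>T. Bs w ! (monomial_word \<mu> ! l)) ^ length (monomial_word \<mu>) \<partial>M)"
          by (intro Bochner_Integration.integral_sum integrable_mult_right int \<mu>)
        thus "Poly_Mapping.lookup P \<mu> *
          (\<Sum>T\<in>Pow {..<length (monomial_word \<mu>)}. (- 1) ^ (length (monomial_word \<mu>) - card T) *
            (\<integral>w. (\<Sum>l\<in>T. Bs w ! (monomial_word \<mu> ! l)) ^ length (monomial_word \<mu>) \<partial>M)) / fact (length (monomial_word \<mu>))
          = (\<integral>w. Poly_Mapping.lookup P \<mu> * (\<Sum>T\<in>Pow {..<length (monomial_word \<mu>)}.
          (- 1) ^ (length (monomial_word \<mu>) - card T) *
          (\<Sum>l\<in>T. Bs w ! (monomial_word \<mu> ! l)) ^ length (monomial_word \<mu>)) / fact (length (monomial_word \<mu>)) \<partial>M)"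
          by (simp only: integral_divide_zero integral_mult_right_zero)
      qed
    qed
  qed
  finally show ?thesis unfolding ops_def Bs_def .
qed

end
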